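(* For any $m=1,2,3$, there is an infinite family of mutually non-isomorphic undirected quantum graphs on $M_2$ containing $m$ quantum edges. They can be chosen as follows, by specifying their adjacency matrices: \begin{itemize} \item for $m=1$: $A(t)=P_3(t)$, $t\in[0,\pi/2]$; \item for $m=2$: $A(t)=P_3(t)+P_2$, $t\in[0,\pi/2]$; \item for $m=3$: $A(t)=P_3(t)+P_2+P_1$, $t\in[0,\pi/2]$. \end{itemize} Here $P_i=\sigma_i\otimes\sigma_i^*$ and $P_3(t)=\sigma_3(t)\otimes\sigma_3(t)^*$ with $\sigma_3(t)=\sigma_3\sin t+\iota\cos t$, where $\sigma_1,\sigma_2,\sigma_3$ are the Pauli matrices and $\iota$ is the $2\times2$ identity matrix. Every other undirected quantum graph on $M_2$ is isomorphic to a member of one of these families, or it equals the empty graph (adjacency matrix $0$) or the full graph (edge projection $1\otimes1$).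
   Context: The finite quantum set $M_n$ is the C*-algebra $C(M_n)=M_n(\mathbb{C})$ equipped with the functional (counit) $\eta^\dag=n\,\mathrm{Tr}$. The Hilbert space $l^2(M_n)$ is $M_n(\mathbb{C})$ with inner product $\langle a,b\rangle=n\,\mathrm{Tr}(a^*b)$. Let $m$ be the multiplication, $\dag$ the adjoint of linear maps with respect to these inner products, and $R^\dag(a\otimes b)=n\,\mathrm{Tr}(ab)$. A quantum graph on $M_n$ is an orthogonal projection $\tilde A\in C(M_n)\otimes C(M_n)^{\rm op}$ (edge projection). Its adjacency matrix is the operator $A=(\mathrm{id}\otimes R^\dag)(\tilde A\otimes\mathrm{id})$ on $l^2(M_n)$; $\tilde A$ and $A$ determine each other. The quantum graph is undirected if $\tilde A$ is invariant under the swap $x\otimes y\mapsto y\otimes x$ (equivalently $A=A^\dag$). Identifying $C(M_n)^{\rm op}$ with $M_n(\mathbb{C})$ by transposition, $\tilde A=\sum \tilde A^{ijkl}e_{ij}\otimes e_{kl}$ is a projection on $\mathbb{C}^n\otimes\mathbb{C}^n$, and $A(e_{kl})=\sum_{i,j}A^{ij}_{kl}e_{ij}$ with $A^{ij}_{kl}=n\tilde A^{ijkl}$. The number of quantum edges is the rank of this projection. For $\xi\in M_n(\mathbb{C})$, $\xi^*$ denotes here the entrywise complex conjugate, and $\xi\otimes\xi^*$ is the operator on $l^2(M_n)$ with $[\xi\otimes\xi^*]^{ij}_{kl}=\xi^i_k\overline{\xi^j_l}$, i.e. $x\mapsto \xi x\xi^\dag$ ($\xi^\dag$ the conjugate transpose).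 Two quantum graphs on $M_n$ with adjacency matrices $A$, $B$ are isomorphic if there is a $*$-automorphism $\phi$ of $M_n(\mathbb{C})$ with $\phi\circ A=B\circ\phi$. Pauli matrices: $\sigma_1=\begin{pmatrix}0&1\\1&0\end{pmatrix}$, $\sigma_2=\begin{pmatrix}0&-\mathrm{i}\\\mathrm{i}&0\end{pmatrix}$, $\sigma_3=\begin{pmatrix}1&0\\0&-1\end{pmatrix}$. *)

theory Defs
  imports "HOL-Analysis.Analysis"
begin

text \<open>
  Elements of \<open>C(M\<^sub>n) \<otimes> C(M\<^sub>n)\<^sup>o\<^sup>p\<close> are represented by matrices indexed by pairs, the opposite algebra
  being identified with the matrix algebra by transposition (see \<open>tensor_op\<close>).  The coefficient
  of \<open>E\<close> at \<open>e\<^sub>i\<^sub>j \<otimes> e\<^sub>k\<^sub>l\<close> (after transposition) is \<open>E $ (i, k) $ (j, l)\<close>.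
\<close>

definition dagger :: "complex^'n^'m \<Rightarrow> complex^'m^'n" where
  "dagger a = (\<chi> i j. cnj (a $ j $ i))"

definition mat_unit :: "'n \<Rightarrow> 'n \<Rightarrow> complex^'n^'n" where
  "mat_unit i j = (\<chi> p q. if p = i \<and> q = j then 1 else 0)"

definition l2_inner :: "complex^'n^'n \<Rightarrow> complex^'n^'n \<Rightarrow> complex" where
  "l2_inner a b = of_nat CARD('n) * trace (dagger a ** b)"

definition R_dagger :: "complex^'n^'n \<Rightarrow> complex^'n^'n \<Rightarrow> complex" where
  "R_dagger a b = of_nat CARD('n) * trace (a ** b)"

text \<open>The elementary tensor \<open>a \<otimes> b\<close>, with \<open>b\<close> an element of the opposite algebra.\<close>

definition tensor_op :: "complex^'n^'n \<Rightarrow> complex^'n^'n \<Rightarrow> complex^('n \<times> 'n)^('n \<times> 'n)" where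
  "tensor_op a b = (\<chi> p q. a $ fst p $ fst q * transpose b $ snd p $ snd q)"

text \<open>The linear extension of \<open>a \<otimes> b \<mapsto> b \<otimes> a\<close>; cf. \<open>swap_op_tensor_op\<close> below.\<close>

definition swap_op :: "complex^('n::finite \<times> 'n)^('n \<times> 'n) \<Rightarrow> complex^('n \<times> 'n)^('n \<times> 'n)" where
  "swap_op E = (\<chi> p q. E $ (snd q, fst q) $ (snd p, fst p))"

definition quantum_graph :: "complex^('n::finite \<times> 'n)^('n \<times> 'n) \<Rightarrow> bool" where
  "quantum_graph E \<longleftrightarrow> E ** E = E \<and> dagger E = E"

definition undirected :: "complex^('n::finite \<times> 'n)^('n \<times> 'n) \<Rightarrow> bool" where
  "undirected E \<longleftrightarrow> swap_op E = E"

text \<open>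
  \<open>A = (id \<otimes> R\<^sup>\<dagger>)(E \<otimes> id)\<close>.  In \<open>E = \<Sum> E\<^sup>i\<^sup>j\<^sup>k\<^sup>l e\<^sub>i\<^sub>j \<otimes> e\<^sub>k\<^sub>l\<close> the second factor is the transpose of the
  element \<open>e\<^sub>l\<^sub>k\<close> of the opposite algebra, hence the index order in \<open>mat_unit l k\<close>.
\<close>

definition adjacency :: "complex^('n::finite \<times> 'n)^('n \<times> 'n) \<Rightarrow> complex^'n^'n \<Rightarrow> complex^'n^'n" where
  "adjacency E x =
     (\<chi> i j. \<Sum>k\<in>UNIV. \<Sum>l\<in>UNIV. E $ (i, k) $ (j, l) * R_dagger (mat_unit l k) x)"

definition star_automorphism :: "(complex^'n^'n \<Rightarrow> complex^'n^'n) \<Rightarrow> bool" where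
  "star_automorphism \<phi> \<longleftrightarrow>
     bij \<phi> \<and>
     (\<forall>x y. \<phi> (x + y) = \<phi> x + \<phi> y) \<and>
     (\<forall>c x. \<phi> (map_matrix ((*) c) x) = map_matrix ((*) c) (\<phi> x)) \<and>
     (\<forall>x y. \<phi> (x ** y) = \<phi> x ** \<phi> y) \<and>
     (\<forall>x. \<phi> (dagger x) = dagger (\<phi> x))"

definition isomorphic_adj ::
  "(complex^'n^'n \<Rightarrow> complex^'n^'n) \<Rightarrow> (complex^'n^'n \<Rightarrow> complex^'n^'n) \<Rightarrow> bool" where
  "isomorphic_adj A B \<longleftrightarrow> (\<exists>\<phi>. star_automorphism \<phi> \<and> \<phi> \<circ> A = B \<circ> \<phi>)"

text \<open>The operator \<open>\<xi> \<otimes> \<xi>\<^sup>*\<close>, where \<open>\<xi>\<^sup>*\<close> is the entrywise conjugate; cf. \<open>tensor_conj_eq\<close> below.\<close>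

definition tensor_conj :: "complex^'n^'n \<Rightarrow> complex^'n^'n \<Rightarrow> complex^'n^'n" where
  "tensor_conj \<xi> x =
     (\<chi> i j. \<Sum>k\<in>UNIV. \<Sum>l\<in>UNIV. \<xi> $ i $ k * cnj (\<xi> $ j $ l) * x $ k $ l)"

definition pauli1 :: "complex^2^2" where
  "pauli1 = vector [vector [0, 1], vector [1, 0]]"

definition pauli2 :: "complex^2^2" where
  "pauli2 = vector [vector [0, - \<i>], vector [\<i>, 0]]"

definition pauli3 :: "complex^2^2" where
  "pauli3 = vector [vector [1, 0], vector [0, - 1]]"

definition pauli3_t :: "real \<Rightarrow> complex^2^2" where
  "pauli3_t t = sin t *\<^sub>R pauli3 + cos t *\<^sub>R mat 1"

text \<open>Meaningful only for \<open>m \<in> {1, 2, 3}\<close>.\<close>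

definition family_adj :: "nat \<Rightarrow> real \<Rightarrow> complex^2^2 \<Rightarrow> complex^2^2" where
  "family_adj m t =
     (if m = 1 then (\<lambda>x. tensor_conj (pauli3_t t) x)
      else if m = 2 then (\<lambda>x. tensor_conj (pauli3_t t) x + tensor_conj pauli2 x)
      else (\<lambda>x. tensor_conj (pauli3_t t) x + tensor_conj pauli2 x + tensor_conj pauli1 x))"


text \<open>The remaining facts confirm the conventions above.\<close>

lemma tensor_op_mult: "tensor_op a b ** tensor_op c d = tensor_op (a ** c) (d ** b)"
proof -
  have "(tensor_op a b ** tensor_op c d) $ p $ q = tensor_op (a ** c) (d ** b) $ p $ q" for p q
  proof -
    have "(tensor_op a b ** tensor_op c d) $ p $ q =
        (\<Sum>(i, j)\<in>UNIV \<times> UNIV. (a $ fst p $ i * c $ i $ fst q) * (d $ snd q $ j * b $ j $ snd p))"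
      by (simp add: tensor_op_def matrix_matrix_mult_def transpose_def case_prod_beta ac_simps)
    also have "\<dots> = tensor_op (a ** c) (d ** b) $ p $ q"
      by (simp add: tensor_op_def matrix_matrix_mult_def transpose_def sum_product
          sum.cartesian_product [symmetric] del: UNIV_Times_UNIV)
    finally show ?thesis .
  qed
  then show ?thesis
    by (simp add: vec_eq_iff)
qed

lemma dagger_tensor_op: "dagger (tensor_op a b) = tensor_op (dagger a) (dagger b)"
  by (simp add: vec_eq_iff tensor_op_def dagger_def transpose_def)

lemma tensor_op_1: "tensor_op (mat 1) (mat 1) = mat 1"
  by (auto simp: vec_eq_iff tensor_op_def mat_def transpose_def prod_eq_iff)

lemma swap_op_tensor_op: "swap_op (tensor_op a b) = tensor_op b a"
  by (simp add: vec_eq_iff tensor_op_def swap_op_def transpose_def)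

lemma sum_mat_unit: "(\<Sum>p\<in>UNIV. \<Sum>q\<in>UNIV. f p q * mat_unit i j $ p $ q) = f i j"
proof -
  have "f p q * mat_unit i j $ p $ q = (if p = i then (if q = j then f p q else 0) else 0)" for p q
    by (simp add: mat_unit_def)
  then have "(\<Sum>p\<in>UNIV. \<Sum>q\<in>UNIV. f p q * mat_unit i j $ p $ q)
      = (\<Sum>p\<in>UNIV. \<Sum>q\<in>UNIV. if p = i then (if q = j then f p q else 0) else 0)"
    by simp
  also have "\<dots> = (\<Sum>p\<in>UNIV. if p = i then (\<Sum>q\<in>UNIV. if q = j then f p q else 0) else 0)"
    by (rule sum.cong) simp_all
  also have "\<dots> = f i j"
    by simp
  finally show ?thesis .
qed

lemma R_dagger_mat_unit:
  fixes x :: "complex^'n^'n"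
  shows "R_dagger (mat_unit l k) x = of_nat CARD('n) * x $ k $ l"
  using sum_mat_unit [of "\<lambda>p q. x $ q $ p" l k]
  by (simp add: R_dagger_def trace_def matrix_matrix_mult_def mult.commute)

lemma adjacency_nth:
  fixes E :: "complex^('n::finite \<times> 'n)^('n \<times> 'n)"
  shows "adjacency E x $ i $ j =
    of_nat CARD('n) * (\<Sum>k\<in>UNIV. \<Sum>l\<in>UNIV. E $ (i, k) $ (j, l) * x $ k $ l)"
  by (simp add: adjacency_def R_dagger_mat_unit sum_distrib_left mult.left_commute)

lemma adjacency_tensor_op: "adjacency (tensor_op a b) x = map_matrix ((*) (R_dagger b x)) a"
proof -
  have "(\<Sum>k\<in>UNIV. \<Sum>l\<in>UNIV. b $ l $ k * x $ k $ l) = trace (b ** x)"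
    unfolding trace_def matrix_matrix_mult_def by (subst sum.swap) simp
  then show ?thesis
    by (simp add: vec_eq_iff adjacency_nth tensor_op_def transpose_def
        R_dagger_def sum_distrib_left [symmetric] mult.assoc mult.left_commute)
qed

lemma adjacency_mat_unit:
  fixes E :: "complex^('n::finite \<times> 'n)^('n \<times> 'n)"
  shows "adjacency E (mat_unit k l) $ i $ j = of_nat CARD('n) * E $ (i, k) $ (j, l)"
  by (simp add: adjacency_nth sum_mat_unit)

lemma inj_adjacency: "inj adjacency"
proof (rule injI)
  fix E F :: "complex^('n::finite \<times> 'n)^('n \<times> 'n)"
  assume "adjacency E = adjacency F"
  then have "E $ (i, k) $ (j, l) = F $ (i, k) $ (j, l)" for i j k l
    using adjacency_mat_unit [of E k l i j] adjacency_mat_unit [of F k l i j] by simp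
  then show "E = F"
    by (simp add: vec_eq_iff)
qed

lemma l2_inner_eq_sum:
  fixes a b :: "complex^'n^'n"
  shows "l2_inner a b = of_nat CARD('n) * (\<Sum>i\<in>UNIV. \<Sum>j\<in>UNIV. cnj (a $ i $ j) * b $ i $ j)"
  unfolding l2_inner_def trace_def matrix_matrix_mult_def dagger_def
  by (subst sum.swap) simp

lemma l2_inner_mat_unit:
  fixes b :: "complex^'n^'n"
  shows "l2_inner (mat_unit i j) b = of_nat CARD('n) * b $ i $ j"
proof -
  have "cnj (mat_unit i j $ p $ q) = mat_unit i j $ p $ q" for p q
    by (simp add: mat_unit_def)
  then show ?thesis
    using sum_mat_unit [of "\<lambda>p q. b $ p $ q" i j] by (simp add: l2_inner_eq_sum mult.commute)
qed

lemma l2_inner_commute: "l2_inner a b = cnj (l2_inner b a)"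
  by (simp add: l2_inner_eq_sum mult.commute)

lemma undirected_iff_self_adjoint:
  fixes E :: "complex^('n::finite \<times> 'n)^('n \<times> 'n)"
  assumes "quantum_graph E"
  shows "undirected E \<longleftrightarrow> (\<forall>x y. l2_inner x (adjacency E y) = l2_inner (adjacency E x) y)"
proof -
  have herm: "cnj (E $ p $ q) = E $ q $ p" for p q
    using assms by (metis (no_types, lifting) dagger_def quantum_graph_def vec_lambda_beta)
  define n where "n = (of_nat CARD('n) :: complex)"
  have n: "n \<noteq> 0" by (simp add: n_def)
  have adj: "adjacency E x $ i $ j = n * (\<Sum>k\<in>UNIV. \<Sum>l\<in>UNIV. E $ (i, k) $ (j, l) * x $ k $ l)"
    for x i j
    by (simp add: adjacency_nth n_def)
  have L: "l2_inner x (adjacency E y) = n * n * (\<Sum>i\<in>UNIV. \<Sum>j\<in>UNIV. \<Sum>k\<in>UNIV. \<Sum>l\<in>UNIV.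
      E $ (i, k) $ (j, l) * cnj (x $ i $ j) * y $ k $ l)" for x y
    by (simp add: l2_inner_eq_sum adj n_def [symmetric] sum_distrib_left ac_simps)
  have R: "l2_inner (adjacency E x) y = n * n * (\<Sum>i\<in>UNIV. \<Sum>j\<in>UNIV. \<Sum>k\<in>UNIV. \<Sum>l\<in>UNIV.
      swap_op E $ (i, k) $ (j, l) * cnj (x $ i $ j) * y $ k $ l)" for x y
  proof -
    have "l2_inner (adjacency E x) y = cnj (l2_inner y (adjacency E x))"
      by (rule l2_inner_commute)
    also have "\<dots> = n * n * (\<Sum>k\<in>UNIV. \<Sum>l\<in>UNIV. \<Sum>i\<in>UNIV. \<Sum>j\<in>UNIV.
        swap_op E $ (i, k) $ (j, l) * cnj (x $ i $ j) * y $ k $ l)"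
      by (simp add: L herm swap_op_def n_def ac_simps)
    also have "(\<Sum>k\<in>UNIV. \<Sum>l\<in>UNIV. \<Sum>i\<in>UNIV. \<Sum>j\<in>UNIV.
        swap_op E $ (i, k) $ (j, l) * cnj (x $ i $ j) * y $ k $ l)
      = (\<Sum>(k,l)\<in>UNIV. \<Sum>(i,j)\<in>UNIV. swap_op E $ (i, k) $ (j, l) * cnj (x $ i $ j) * y $ k $ l)"
      by (simp add: UNIV_Times_UNIV [symmetric] sum.cartesian_product [symmetric] del: UNIV_Times_UNIV)
    also have "\<dots> = (\<Sum>(i,j)\<in>UNIV. \<Sum>(k,l)\<in>UNIV.
        swap_op E $ (i, k) $ (j, l) * cnj (x $ i $ j) * y $ k $ l)"
      unfolding case_prod_beta by (rule sum.swap)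
    also have "\<dots> = (\<Sum>i\<in>UNIV. \<Sum>j\<in>UNIV. \<Sum>k\<in>UNIV. \<Sum>l\<in>UNIV.
        swap_op E $ (i, k) $ (j, l) * cnj (x $ i $ j) * y $ k $ l)"
      by (simp add: UNIV_Times_UNIV [symmetric] sum.cartesian_product [symmetric] del: UNIV_Times_UNIV)
    finally show ?thesis .
  qed
  show ?thesis
  proof
    assume "undirected E"
    then show "\<forall>x y. l2_inner x (adjacency E y) = l2_inner (adjacency E x) y"
      by (simp add: L R undirected_def)
  next
    assume *: "\<forall>x y. l2_inner x (adjacency E y) = l2_inner (adjacency E x) y"
    have "E $ (l, j) $ (k, i) = E $ (i, k) $ (j, l)" for i j k l
    proof -
      have "n * (n * E $ (i, k) $ (j, l)) = l2_inner (mat_unit i j) (adjacency E (mat_unit k l))"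
        by (simp add: l2_inner_mat_unit adjacency_mat_unit n_def)
      also have "\<dots> = cnj (l2_inner (mat_unit k l) (adjacency E (mat_unit i j)))"
        using * l2_inner_commute by metis
      also have "\<dots> = n * (n * E $ (l, j) $ (k, i))"
        by (simp add: l2_inner_mat_unit adjacency_mat_unit n_def herm)
      finally show ?thesis using n by simp
    qed
    then show "undirected E"
      by (simp add: undirected_def swap_op_def vec_eq_iff)
  qed
qed

lemma tensor_conj_eq: "tensor_conj \<xi> x = \<xi> ** x ** dagger \<xi>"
proof -
  have "tensor_conj \<xi> x $ i $ j = (\<xi> ** x ** dagger \<xi>) $ i $ j" for i j
    unfolding tensor_conj_def matrix_matrix_mult_def dagger_def
    by (simp add: sum_distrib_left sum_distrib_right ac_simps) (rule sum.swap)
  then show ?thesis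
    by (simp add: vec_eq_iff)
qed

end

theory Submission
  imports Defs
begin

text \<open>
  Read the entries of an \<open>n \<times> n\<close> matrix as a vector in \<open>\<complex>\<^sup>n \<otimes> \<complex>\<^sup>n\<close>.  An edge projection is then the
  orthogonal projection onto a complex space \<open>V\<close> of matrices, and invariance under the swap says
  that \<open>V\<close> is closed under the conjugate transpose.  Hence \<open>V\<close> is the complex span of the real space
  of its Hermitian members, and on Hermitian matrices the complex inner product is real.  So
  undirected quantum graphs correspond to real subspaces of the Hermitian matrices: if \<open>B\<close> is an
  orthonormal basis of the subspace, then the edge projection is \<open>\<Sum>b\<in>B. |b\<rangle>\<langle>b|\<close> (\<open>edge_proj_eqI\<close>), the
  number of edges is \<open>card B\<close> (\<open>rank_edge_proj\<close>), and the adjacency matrix is \<open>n \<Sum>b\<in>B. b \<otimes> b\<^sup>*\<close>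
  (\<open>adjacency_edge_proj\<close>).

  For \<open>n = 2\<close> the Hermitian matrices form \<open>\<real> \<oplus> \<real>\<^sup>3\<close>, the multiples of \<open>1\<close> and the traceless ones, with
  the Pauli matrices as axes.  Conjugation by a unitary matrix fixes the first summand and rotates
  the second, and it maps one quantum graph to an isomorphic one.  A nonzero proper subspace has a
  basis consisting of one unit vector \<open>u\<close> and at most two unit vectors \<open>B\<close> in \<open>\<real>\<^sup>3\<close>
  (\<open>orthonormal_basis_adapted\<close>).  Up to sign, \<open>u\<close> is \<open>cos t\<close> times the normalized identity plus \<open>sin t\<close>
  times a unit vector \<open>a\<close> of \<open>\<real>\<^sup>3\<close> orthogonal to \<open>B\<close>, with \<open>t\<close> between \<open>0\<close> and \<open>\<pi>/2\<close> (\<open>polar_form\<close>).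
  A rotation moves \<open>a\<close> to the third axis and the members of \<open>B\<close> to the second and first axes
  (\<open>frame_rotation\<close>), which turns the quantum graph into \<open>A(t)\<close> (\<open>isomorphic_family\<close>).  The rotations
  needed are products of half turns, which are conjugations by traceless Hermitian matrices of
  square \<open>1\<close>.

  Different parameters give non-isomorphic graphs because an isomorphism preserves the trace of the
  adjacency matrix as an operator.  The trace of \<open>\<xi> \<otimes> \<xi>\<^sup>*\<close> is \<open>|Tr \<xi>|\<^sup>2\<close>, and only the summand
  \<open>P\<^sub>3(t)\<close> contributes, with \<open>4 cos\<^sup>2 t\<close>; this is injective on the parameter interval.
\<close>

section \<open>Projections onto spans of Hermitian matrices\<close>

lemma hermitian_nth:
  assumes "dagger a = a"
  shows "cnj (a $ i $ j) = a $ j $ i"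
  using arg_cong [OF assms, of "\<lambda>a. a $ j $ i"] by (simp add: dagger_def)

lemma dagger_dagger: "dagger (dagger a) = a"
  by (simp add: vec_eq_iff dagger_def)

lemma dagger_mat_1: "dagger (mat 1) = mat 1"
  by (simp add: vec_eq_iff dagger_def mat_def)

lemma dagger_scaleR: "dagger (r *\<^sub>R a) = r *\<^sub>R dagger a"
  by (simp add: dagger_def vec_eq_iff)

lemma dagger_mult: "dagger (a ** b) = dagger b ** dagger a"
  by (simp add: vec_eq_iff dagger_def matrix_matrix_mult_def mult.commute)

lemma matrix_add_rdistrib: "(a + b) ** c = a ** c + b ** c" for a b c :: "complex^'n^'n"
  by (simp add: vec_eq_iff matrix_matrix_mult_def distrib_right sum.distrib)

definition flat :: "complex^'n^'n \<Rightarrow> complex^('n::finite \<times> 'n)" where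
  "flat x = (\<chi> p. x $ fst p $ snd p)"

text \<open>For a Hermitian orthonormal family this is the orthogonal projection \<open>\<Sum>b\<in>B. |b\<rangle>\<langle>b|\<close> onto its complex span.\<close>
definition edge_proj :: "(complex^'n^'n) set \<Rightarrow> complex^('n::finite \<times> 'n)^('n \<times> 'n)" where
  "edge_proj B = (\<chi> p q. \<Sum>b\<in>B. flat b $ p * cnj (flat b $ q))"

text \<open>
  Orthonormality refers to the real inner product \<open>Re (Tr (a\<^sup>\<dagger> b))\<close> of matrices as a Euclidean space.
  On Hermitian matrices it agrees, up to the factor \<open>n\<close>, with \<open>l2_inner\<close>; see \<open>l2_inner_hermitian\<close>.
\<close>
definition hermitian_orthonormal :: "(complex^'n^'n) set \<Rightarrow> bool" where
  "hermitian_orthonormal B \<longleftrightarrow>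
     finite B \<and> pairwise orthogonal B \<and> (\<forall>b\<in>B. dagger b = b \<and> norm b = 1)"

lemma flat_exhaust: "\<exists>x. v = flat x"
  by (rule exI [of _ "\<chi> i j. v $ (i, j)"]) (simp add: flat_def vec_eq_iff)

lemma sum_flat:
  fixes x y :: "complex^'n^'n"
  shows "(\<Sum>p\<in>UNIV. cnj (flat x $ p) * flat y $ p) = l2_inner x y / of_nat CARD('n)"
proof -
  have "(\<Sum>p\<in>UNIV. cnj (flat x $ p) * flat y $ p) = (\<Sum>(i, j)\<in>UNIV \<times> UNIV. cnj (x $ i $ j) * y $ i $ j)"
    unfolding UNIV_Times_UNIV by (simp add: flat_def case_prod_beta)
  also have "\<dots> = l2_inner x y / of_nat CARD('n)"
    unfolding sum.cartesian_product [symmetric] by (simp add: l2_inner_eq_sum)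
  finally show ?thesis .
qed

lemma l2_inner_Re: "Re (l2_inner x y) = CARD('n) * (x \<bullet> y)" for x y :: "complex^'n^'n"
  by (simp add: l2_inner_eq_sum inner_vec_def inner_complex_def)

text \<open>
  For Hermitian matrices \<open>Tr (a b) = Tr (b a)\<close> makes the complex inner product symmetric, hence real.
  This is what lets real orthonormal bases stand for complex ones.
\<close>
lemma l2_inner_hermitian:
  fixes a b :: "complex^'n^'n"
  assumes "dagger a = a" "dagger b = b"
  shows "l2_inner a b = of_real (of_nat CARD('n) * (a \<bullet> b))"
proof -
  have "l2_inner a b = l2_inner b a"
    unfolding l2_inner_def assms by (simp only: trace_mul_sym [of a b])
  then have "cnj (l2_inner a b) = l2_inner a b"
    using l2_inner_commute [of a b] by simp
  then have "l2_inner a b = of_real (Re (l2_inner a b))"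
    by (simp add: complex_eq_iff)
  then show ?thesis
    by (simp add: l2_inner_Re)
qed

lemma edge_proj_mult_flat:
  fixes x :: "complex^'n^'n"
  shows "edge_proj B *v flat x = (\<Sum>b\<in>B. (l2_inner b x / of_nat CARD('n)) *s flat b)"
proof -
  have "(edge_proj B *v flat x) $ p = (\<Sum>b\<in>B. flat b $ p * (\<Sum>q\<in>UNIV. cnj (flat b $ q) * flat x $ q))" for p
  proof -
    have "(edge_proj B *v flat x) $ p = (\<Sum>q\<in>UNIV. \<Sum>b\<in>B. flat b $ p * cnj (flat b $ q) * flat x $ q)"
      by (simp add: edge_proj_def matrix_vector_mult_def sum_distrib_right)
    also have "\<dots> = (\<Sum>b\<in>B. \<Sum>q\<in>UNIV. flat b $ p * cnj (flat b $ q) * flat x $ q)"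
      by (rule sum.swap)
    finally show ?thesis
      by (simp add: sum_distrib_left mult.assoc)
  qed
  then show ?thesis
    by (simp add: vec_eq_iff sum_flat) (simp add: mult.commute)
qed

lemma edge_proj_fixes:
  assumes "hermitian_orthonormal B" "b \<in> B"
  shows "edge_proj B *v flat b = flat b"
proof -
  have *: "c \<bullet> b = (if c = b then 1 else 0)" if "c \<in> B" for c
    using assms that unfolding hermitian_orthonormal_def pairwise_def orthogonal_def
    by (auto simp: norm_eq_1)
  have "edge_proj B *v flat b = (\<Sum>c\<in>B. of_real (c \<bullet> b) *s flat c)"
    using assms unfolding edge_proj_mult_flat hermitian_orthonormal_def
    by (intro sum.cong) (simp_all add: l2_inner_hermitian)
  also have "\<dots> = (\<Sum>c\<in>B. if c = b then flat c else 0)"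
    using * by (intro sum.cong) auto
  also have "\<dots> = flat b"
    using assms by (simp add: hermitian_orthonormal_def)
  finally show ?thesis .
qed

lemma mult_edge_proj:
  assumes "\<And>b. b \<in> B \<Longrightarrow> E *v flat b = flat b"
  shows "E ** edge_proj B = edge_proj B"
proof -
  have "(E ** edge_proj B) $ p $ q = edge_proj B $ p $ q" for p q
  proof -
    have "(E ** edge_proj B) $ p $ q = (\<Sum>r\<in>UNIV. \<Sum>b\<in>B. E $ p $ r * flat b $ r * cnj (flat b $ q))"
      by (simp add: edge_proj_def matrix_matrix_mult_def sum_distrib_left mult.assoc)
    also have "\<dots> = (\<Sum>b\<in>B. \<Sum>r\<in>UNIV. E $ p $ r * flat b $ r * cnj (flat b $ q))"
      by (rule sum.swap)
    also have "\<dots> = (\<Sum>b\<in>B. (E *v flat b) $ p * cnj (flat b $ q))"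
      by (simp add: matrix_vector_mult_def sum_distrib_right)
    finally show ?thesis
      using assms by (simp add: edge_proj_def)
  qed
  then show ?thesis
    by (simp add: vec_eq_iff)
qed

lemma dagger_edge_proj: "dagger (edge_proj B) = edge_proj B"
  by (simp add: vec_eq_iff dagger_def edge_proj_def mult.commute)

lemma quantum_graph_edge_proj:
  assumes "hermitian_orthonormal B"
  shows "quantum_graph (edge_proj B)"
  using assms by (simp add: quantum_graph_def dagger_edge_proj mult_edge_proj edge_proj_fixes)

lemma undirected_edge_proj:
  assumes "hermitian_orthonormal B"
  shows "undirected (edge_proj B)"
proof -
  have "cnj (b $ i $ j) = b $ j $ i" if "b \<in> B" for b i j
    using assms that by (simp add: hermitian_orthonormal_def hermitian_nth)
  then show ?thesis
    by (simp add: undirected_def swap_op_def edge_proj_def flat_def vec_eq_iff mult.commute)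
qed

lemma adjacency_edge_proj:
  fixes B :: "(complex^'n^'n) set"
  shows "adjacency (edge_proj B) x = real CARD('n) *\<^sub>R (\<Sum>b\<in>B. tensor_conj b x)"
proof -
  have "(\<Sum>k\<in>UNIV. \<Sum>l\<in>UNIV. edge_proj B $ (i, k) $ (j, l) * x $ k $ l)
    = (\<Sum>b\<in>B. tensor_conj b x) $ i $ j" for i j
  proof -
    have "(\<Sum>k\<in>UNIV. \<Sum>l\<in>UNIV. edge_proj B $ (i, k) $ (j, l) * x $ k $ l)
      = (\<Sum>k\<in>UNIV. \<Sum>b\<in>B. \<Sum>l\<in>UNIV. b $ i $ k * cnj (b $ j $ l) * x $ k $ l)"
      unfolding edge_proj_def flat_def
      by (simp add: sum_distrib_right) (rule sum.cong [OF refl], rule sum.swap)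
    also have "\<dots> = (\<Sum>b\<in>B. \<Sum>k\<in>UNIV. \<Sum>l\<in>UNIV. b $ i $ k * cnj (b $ j $ l) * x $ k $ l)"
      by (rule sum.swap)
    finally show ?thesis
      by (simp add: tensor_conj_def)
  qed
  then show ?thesis
    unfolding vec_eq_iff adjacency_nth vector_scaleR_component by (simp add: scaleR_conv_of_real)
qed

text \<open>The rank is a dimension of the row space, whose basis consists of the conjugated vectors of \<open>B\<close>.\<close>
lemma rank_edge_proj:
  fixes B :: "(complex^'n^'n) set"
  assumes "hermitian_orthonormal B"
  shows "rank (edge_proj B) = card B"
proof -
  define f where "f b = (\<chi> p. cnj (flat b $ p))" for b :: "complex^'n^'n"
  have fin: "finite B" using assms by (simp add: hermitian_orthonormal_def)
  have f: "f b = (\<Sum>p\<in>UNIV. cnj (flat b $ p) *s row p (edge_proj B))" if "b \<in> B" for b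
  proof -
    have "cnj ((edge_proj B *v flat b) $ q) = f b $ q" for q
      using edge_proj_fixes [OF assms that] by (simp add: f_def)
    moreover have "cnj (edge_proj B $ q $ p) = edge_proj B $ p $ q" for p q
      by (rule hermitian_nth [OF dagger_edge_proj])
    ultimately show ?thesis
      by (simp add: vec_eq_iff row_def matrix_vector_mult_def mult.commute)
  qed
  have row: "row p (edge_proj B) = (\<Sum>b\<in>B. flat b $ p *s f b)" for p
    by (simp add: vec_eq_iff row_def edge_proj_def f_def)
  have "vec.span (rows (edge_proj B)) = vec.span (f ` B)"
  proof (rule antisym)
    show "vec.span (rows (edge_proj B)) \<subseteq> vec.span (f ` B)"
    proof (rule vec.span_minimal)
      show "rows (edge_proj B) \<subseteq> vec.span (f ` B)"
        unfolding rows_def row by (auto intro!: vec.span_sum vec.span_scale intro: vec.span_base)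
    qed simp
    show "vec.span (f ` B) \<subseteq> vec.span (rows (edge_proj B))"
    proof (rule vec.span_minimal)
      have "f b \<in> vec.span (rows (edge_proj B))" if "b \<in> B" for b
        unfolding f [OF that] rows_def by (auto intro!: vec.span_sum vec.span_scale intro: vec.span_base)
      then show "f ` B \<subseteq> vec.span (rows (edge_proj B))"
        by auto
    qed simp
  qed
  moreover have inj: "inj_on f B"
    by (auto simp: inj_on_def f_def vec_eq_iff flat_def)
  have "vec.independent (f ` B)"
  proof (rule vec.independent_if_scalars_zero)
    show "finite (f ` B)" using fin by simp
  next
    fix u x assume u: "(\<Sum>x\<in>f ` B. u x *s x) = 0" and "x \<in> f ` B"
    then obtain b where b: "b \<in> B" "x = f b" by auto
    have "(\<Sum>p\<in>UNIV. (\<Sum>c\<in>B. u (f c) *s f c) $ p * flat b $ p) = 0"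
      using u by (simp add: sum.reindex [OF inj])
    also have "(\<Sum>p\<in>UNIV. (\<Sum>c\<in>B. u (f c) *s f c) $ p * flat b $ p) =
      (\<Sum>c\<in>B. u (f c) * (\<Sum>p\<in>UNIV. cnj (flat c $ p) * flat b $ p))"
      by (simp add: f_def sum_distrib_left sum_distrib_right mult.assoc) (rule sum.swap)
    also have "\<dots> = (\<Sum>c\<in>B. if c = b then u (f c) else 0)"
      using assms b unfolding hermitian_orthonormal_def pairwise_def orthogonal_def
      by (intro sum.cong) (auto simp: sum_flat l2_inner_hermitian norm_eq_1)
    also have "\<dots> = u x"
      using fin b by simp
    finally show "u x = 0" .
  qed
  ultimately have "vec.dim (rows (edge_proj B)) = card (f ` B)"
    by (metis vec.dim_eq_card vec.dim_span)
  then show ?thesis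
    by (simp add: row_rank_def_gen card_image inj)
qed

text \<open>
  Hermiticity together with swap invariance makes the edge projection commute with the conjugate
  transpose, viewed as an antilinear map on vectors; its range is therefore closed under it.
\<close>
lemma mult_flat_dagger:
  fixes E :: "complex^('n::finite \<times> 'n)^('n \<times> 'n)"
  assumes "quantum_graph E" "undirected E" and "E *v flat x = flat y"
  shows "E *v flat (dagger x) = flat (dagger y)"
proof -
  have herm: "cnj (E $ p $ q) = E $ q $ p" for p q
    using assms by (simp add: quantum_graph_def hermitian_nth)
  have swap: "E $ (l, j) $ (k, i) = E $ (i, k) $ (j, l)" for i j k l
    using arg_cong [OF assms(2) [unfolded undirected_def], of "\<lambda>E. E $ (i, k) $ (j, l)"]
    by (simp add: swap_op_def)
  have mult: "(E *v flat x) $ (i, k) = (\<Sum>j\<in>UNIV. \<Sum>l\<in>UNIV. E $ (i, k) $ (j, l) * x $ j $ l)" for x i k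
    unfolding sum.cartesian_product UNIV_Times_UNIV
    by (simp add: matrix_vector_mult_def flat_def case_prod_beta)
  have "(E *v flat (dagger x)) $ (i, k) = flat (dagger y) $ (i, k)" for i k
  proof -
    have "(E *v flat (dagger x)) $ (i, k) = (\<Sum>j\<in>UNIV. \<Sum>l\<in>UNIV. E $ (i, k) $ (j, l) * cnj (x $ l $ j))"
      by (simp add: mult dagger_def)
    also have "\<dots> = (\<Sum>l\<in>UNIV. \<Sum>j\<in>UNIV. E $ (i, k) $ (j, l) * cnj (x $ l $ j))"
      by (rule sum.swap)
    also have "\<dots> = cnj (\<Sum>l\<in>UNIV. \<Sum>j\<in>UNIV. E $ (k, i) $ (l, j) * x $ l $ j)"
      unfolding cnj_sum complex_cnj_mult herm swap ..
    also have "\<dots> = flat (dagger y) $ (i, k)"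
      unfolding mult [symmetric] assms(3) by (simp add: flat_def dagger_def)
    finally show ?thesis .
  qed
  then show ?thesis
    by (simp add: vec_eq_iff)
qed

lemma flat_linear:
  "flat (x + y) = flat x + flat y" "flat (c *\<^sub>R x) = c *\<^sub>R flat x" "flat 0 = 0"
  by (simp_all add: flat_def vec_eq_iff)

lemma subspace_fixed:
  fixes E :: "complex^('b::finite \<times> 'b)^('b \<times> 'b)"
  shows "subspace {x. E *v flat x = flat x}"
proof -
  have "c *\<^sub>R v = of_real c *s v" for c and v :: "complex^('b \<times> 'b)"
    unfolding vec_eq_iff vector_scaleR_component by (simp add: scaleR_conv_of_real)
  then show ?thesis
    by (simp add: subspace_def flat_linear matrix_vector_right_distrib
        vector_scalar_commute)
qed

text \<open>
  An undirected quantum graph is determined by the Hermitian matrices in its range.  Any matrix \<open>x\<close> in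
  the range splits as \<open>(x + x\<^sup>\<dagger>)/2 - \<i> (\<i> (x - x\<^sup>\<dagger>))/2\<close> into Hermitian members of the range, so the projection
  \<open>F\<close> onto the span of \<open>B\<close> satisfies \<open>F E = E\<close>; conversely \<open>E F = F\<close>, and taking adjoints gives \<open>E = F\<close>.
\<close>
lemma edge_proj_eqI:
  assumes E: "quantum_graph E" "undirected E" and B: "hermitian_orthonormal B"
    and span: "span B = {x. dagger x = x \<and> E *v flat x = flat x}"
  shows "E = edge_proj B"
proof -
  let ?F = "edge_proj B"
  have "span B \<subseteq> {x. ?F *v flat x = flat x}"
    using edge_proj_fixes [OF B] by (intro span_minimal subspace_fixed) auto
  then have fixed: "?F *v flat x = flat x" if "dagger x = x" "E *v flat x = flat x" for x
    using span that by blast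
  have fixed': "?F *v flat x = flat x" if x: "E *v flat x = flat x" for x
  proof -
    define h where "h = x + dagger x"
    (* Both h and k are Hermitian and fixed by E, and x = (h - i k) / 2. *)
    define k where "k = (\<chi> i j. \<i> * (x $ i $ j - cnj (x $ j $ i)))"
    have x': "E *v flat (dagger x) = flat (dagger x)"
      by (rule mult_flat_dagger [OF E x])
    have k: "flat k = \<i> *s (flat x - flat (dagger x))"
      by (simp add: k_def flat_def dagger_def vec_eq_iff right_diff_distrib)
    have "?F *v flat h = flat h"
      using x x' by (intro fixed)
        (simp_all add: h_def flat_linear matrix_vector_right_distrib dagger_def vec_eq_iff)
    moreover have "?F *v flat k = flat k"
    proof (rule fixed)
      show "dagger k = k"
        by (simp add: k_def dagger_def vec_eq_iff algebra_simps)
      show "E *v flat k = flat k"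
        by (simp only: k vector_scalar_commute matrix_vector_mult_diff_distrib x x')
    qed
    moreover have "flat x = (1/2) *s (flat h - \<i> *s flat k)"
      by (simp add: h_def k flat_linear vec_eq_iff algebra_simps)
    ultimately show ?thesis
      by (simp add: matrix_vector_mult_diff_distrib vector_scalar_commute)
  qed
  have "?F *v (E *v v) = E *v v" for v
  proof -
    obtain y where y: "E *v v = flat y"
      using flat_exhaust by blast
    have "E *v flat y = flat y"
      unfolding y [symmetric] using E by (simp add: matrix_vector_mul_assoc quantum_graph_def)
    then show ?thesis
      unfolding y by (rule fixed')
  qed
  then have "?F ** E = E"
    by (simp add: matrix_eq matrix_vector_mul_assoc)
  then have "E = dagger (?F ** E)"
    using E by (simp add: quantum_graph_def)
  also have "\<dots> = E ** ?F"
    using E by (simp add: dagger_mult dagger_edge_proj quantum_graph_def)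
  also have "\<dots> = ?F"
  proof (rule mult_edge_proj)
    show "E *v flat b = flat b" if "b \<in> B" for b
      using span_base [OF that] unfolding span by simp
  qed
  finally show ?thesis .
qed

section \<open>The trace of an adjacency operator\<close>

definition complex_linear :: "(complex^'n^'n \<Rightarrow> complex^'n^'n) \<Rightarrow> bool" where
  "complex_linear f \<longleftrightarrow> (\<forall>x y. f (x + y) = f x + f y) \<and>
     (\<forall>c x. f (map_matrix ((*) c) x) = map_matrix ((*) c) (f x))"

text \<open>
  The matrix of an operator with respect to the matrix units, so that \<open>trace (op_matrix f)\<close> is the
  trace of \<open>f\<close> as an operator on the space of matrices.
\<close>
definition op_matrix ::
  "(complex^'n^'n \<Rightarrow> complex^'n^'n) \<Rightarrow> complex^('n::finite \<times> 'n)^('n \<times> 'n)" where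
  "op_matrix f = (\<chi> p q. f (mat_unit (fst q) (snd q)) $ fst p $ snd p)"

lemma flat_complex_linear:
  assumes "complex_linear f"
  shows "flat (f x) = op_matrix f *v flat x"
proof -
  interpret additive f
    using assms by unfold_locales (simp add: complex_linear_def)
  have "(\<Sum>q\<in>UNIV. flat x $ q * mat_unit (fst q) (snd q) $ i $ j) = x $ i $ j" for i j
  proof -
    have "(\<Sum>q\<in>UNIV. flat x $ q * mat_unit (fst q) (snd q) $ i $ j) =
        (\<Sum>q\<in>UNIV. if q = (i, j) then flat x $ q else 0)"
      by (rule sum.cong) (auto simp: mat_unit_def)
    then show ?thesis
      by (simp add: flat_def)
  qed
  then have "(\<Sum>q\<in>UNIV. map_matrix ((*) (flat x $ q)) (mat_unit (fst q) (snd q))) = x"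
    by (simp add: vec_eq_iff)
  then have "f x = f (\<Sum>q\<in>UNIV. map_matrix ((*) (flat x $ q)) (mat_unit (fst q) (snd q)))"
    by simp
  also have "\<dots> = (\<Sum>q\<in>UNIV. map_matrix ((*) (flat x $ q)) (f (mat_unit (fst q) (snd q))))"
    using assms by (simp add: sum complex_linear_def)
  finally have "f x = (\<Sum>q\<in>UNIV. map_matrix ((*) (flat x $ q)) (f (mat_unit (fst q) (snd q))))" .
  then have "f x $ i $ j = (op_matrix f *v flat x) $ (i, j)" for i j
    by (simp add: op_matrix_def matrix_vector_mult_def mult.commute)
  then have "flat (f x) $ p = (op_matrix f *v flat x) $ p" for p
    by (simp add: flat_def [of "f x"])
  then show ?thesis
    by (simp add: vec_eq_iff)
qed

lemma op_matrix_comp: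
  assumes "complex_linear f"
  shows "op_matrix (f \<circ> g) = op_matrix f ** op_matrix g"
proof -
  have "op_matrix (f \<circ> g) $ p $ q = flat (f (g (mat_unit (fst q) (snd q)))) $ p" for p q
    by (simp add: op_matrix_def flat_def)
  also have "\<dots> p q = (op_matrix f ** op_matrix g) $ p $ q" for p q
    unfolding flat_complex_linear [OF assms]
    by (simp add: matrix_vector_mult_def matrix_matrix_mult_def op_matrix_def flat_def)
  finally show ?thesis
    by (simp add: vec_eq_iff)
qed

lemma op_matrix_id: "op_matrix id = mat 1"
  by (auto simp: op_matrix_def mat_unit_def mat_def vec_eq_iff)

text \<open>
  A star automorphism is in particular an invertible linear map, so isomorphic adjacency matrices are
  similar operators and have the same trace.
\<close>
lemma trace_op_matrix_isomorphic:
  assumes "isomorphic_adj A B" "complex_linear B"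
  shows "trace (op_matrix A) = trace (op_matrix B)"
proof -
  obtain \<phi> where \<phi>: "star_automorphism \<phi>" "\<phi> \<circ> A = B \<circ> \<phi>"
    using assms by (auto simp: isomorphic_adj_def)
  then have lin: "complex_linear \<phi>" and "surj \<phi>"
    by (simp_all add: star_automorphism_def complex_linear_def bij_is_surj)
  then have "\<phi> \<circ> inv \<phi> = id"
    by (simp only: surj_iff)
  then have right_inverse: "op_matrix \<phi> ** op_matrix (inv \<phi>) = mat 1"
    unfolding op_matrix_comp [OF lin, symmetric] by (simp add: op_matrix_id)
  then have left_inverse: "op_matrix (inv \<phi>) ** op_matrix \<phi> = mat 1"
    by (simp add: matrix_left_right_inverse)
  have "op_matrix \<phi> ** op_matrix A = op_matrix B ** op_matrix \<phi>"
    unfolding op_matrix_comp [OF lin, symmetric] op_matrix_comp [OF assms(2), symmetric] \<phi>(2) ..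
  then have "op_matrix A = op_matrix (inv \<phi>) ** (op_matrix B ** op_matrix \<phi>)"
    by (metis left_inverse matrix_mul_assoc matrix_mul_lid)
  then have "trace (op_matrix A) = trace (op_matrix B ** op_matrix \<phi> ** op_matrix (inv \<phi>))"
    by (simp only: trace_mul_sym [of "op_matrix (inv \<phi>)"])
  also have "\<dots> = trace (op_matrix B)"
    by (simp add: right_inverse matrix_mul_assoc [symmetric])
  finally show ?thesis .
qed

lemma complex_linear_tensor_conj: "complex_linear (tensor_conj \<xi>)"
  by (simp add: complex_linear_def tensor_conj_def vec_eq_iff distrib_left sum.distrib
      sum_distrib_left mult.left_commute)

lemma complex_linear_add:
  assumes "complex_linear f" "complex_linear g"
  shows "complex_linear (\<lambda>x. f x + g x)"
  using assms by (simp add: complex_linear_def vec_eq_iff distrib_left)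

lemma op_matrix_add: "op_matrix (\<lambda>x. f x + g x) = op_matrix f + op_matrix g"
  by (simp add: op_matrix_def vec_eq_iff)

lemma trace_op_matrix_tensor_conj:
  "trace (op_matrix (tensor_conj \<xi>)) = trace \<xi> * cnj (trace \<xi>)"
proof -
  have "tensor_conj \<xi> (mat_unit k l) $ i $ j = \<xi> $ i $ k * cnj (\<xi> $ j $ l)" for i j k l
    by (simp add: tensor_conj_def sum_mat_unit)
  then have "trace (op_matrix (tensor_conj \<xi>)) =
      (\<Sum>(k, l)\<in>UNIV \<times> UNIV. \<xi> $ k $ k * cnj (\<xi> $ l $ l))"
    unfolding UNIV_Times_UNIV by (simp add: trace_def op_matrix_def case_prod_beta)
  also have "\<dots> = trace \<xi> * cnj (trace \<xi>)"
    unfolding sum.cartesian_product [symmetric] by (simp add: trace_def sum_product)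
  finally show ?thesis .
qed

lemma complex_linear_family_adj: "complex_linear (family_adj m t)"
  by (simp add: family_adj_def complex_linear_tensor_conj complex_linear_add)

lemma trace_op_matrix_family_adj: "trace (op_matrix (family_adj m t)) = of_real (4 * (cos t)\<^sup>2)"
proof -
  have "trace pauli1 = 0" "trace pauli2 = 0" "trace (pauli3_t t) = of_real (2 * cos t)"
    by (simp_all add: trace_def sum_2 pauli1_def pauli2_def pauli3_def pauli3_t_def mat_def
        complex_eq_iff)
  then show ?thesis
    by (simp add: family_adj_def op_matrix_add trace_add trace_op_matrix_tensor_conj power2_eq_square)
qed

text \<open>
  The operator trace \<open>4 cos\<^sup>2 t\<close> recovers \<open>t\<close>, since the cosine is nonnegative and injective on the
  interval.
\<close>
lemma not_isomorphic_family_adj: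
  assumes "s \<in> {0..pi/2}" "t \<in> {0..pi/2}" "s \<noteq> t"
  shows "\<not> isomorphic_adj (family_adj m s) (family_adj m t)"
proof
  assume "isomorphic_adj (family_adj m s) (family_adj m t)"
  then have "complex_of_real (4 * (cos s)\<^sup>2) = of_real (4 * (cos t)\<^sup>2)"
    unfolding trace_op_matrix_family_adj [of m, symmetric]
    by (rule trace_op_matrix_isomorphic) (rule complex_linear_family_adj)
  then have "(cos s)\<^sup>2 = (cos t)\<^sup>2"
    unfolding of_real_eq_iff by simp
  moreover have "cos s \<ge> 0" "cos t \<ge> 0"
    using assms by (auto intro!: cos_ge_zero)
  ultimately have "cos s = cos t"
    by simp
  then show False
    using assms cos_inj_pi [of s t] by auto
qed

lemma infinite_family_adj: "infinite (family_adj m ` {0..pi/2})"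
proof -
  have "isomorphic_adj A A" for A :: "complex^2^2 \<Rightarrow> complex^2^2"
    unfolding isomorphic_adj_def by (rule exI [of _ id]) (simp add: star_automorphism_def)
  then have "family_adj m s \<noteq> family_adj m t" if "s \<in> {0..pi/2}" "t \<in> {0..pi/2}" "s \<noteq> t" for s t
    using not_isomorphic_family_adj [OF that, of m] by auto
  then have "inj_on (family_adj m) {0..pi/2}"
    by (meson inj_onI)
  then show ?thesis
    using infinite_Icc [of 0 "pi/2"] by (simp add: finite_image_iff)
qed

section \<open>Conjugation by unitary matrices\<close>

definition conj_by :: "complex^'n^'n \<Rightarrow> complex^'n^'n \<Rightarrow> complex^'n^'n" where
  "conj_by u x = u ** x ** dagger u"

definition unitary :: "complex^'n^'n \<Rightarrow> bool" where
  "unitary u \<longleftrightarrow> dagger u ** u = mat 1"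

lemma unitary_right: "unitary u \<Longrightarrow> u ** dagger u = mat 1"
  by (simp add: unitary_def matrix_left_right_inverse)

lemma unitary_mult: "unitary u \<Longrightarrow> unitary v \<Longrightarrow> unitary (u ** v)"
  unfolding unitary_def dagger_mult by (metis matrix_mul_assoc matrix_mul_lid)

lemma conj_by_mult: "conj_by (u ** v) x = conj_by u (conj_by v x)"
  by (simp add: conj_by_def dagger_mult matrix_mul_assoc)

lemma conj_by_cancel: "unitary u \<Longrightarrow> conj_by (dagger u) (conj_by u x) = x"
  unfolding conj_by_mult [symmetric] unitary_def by (simp add: conj_by_def dagger_mat_1)

lemma conj_by_add: "conj_by u (x + y) = conj_by u x + conj_by u y"
  by (simp add: conj_by_def matrix_add_ldistrib matrix_add_rdistrib)

lemma conj_by_map: "conj_by u (map_matrix ((*) c) x) = map_matrix ((*) c) (conj_by u x)"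
  by (simp add: vec_eq_iff conj_by_def matrix_matrix_mult_def sum_distrib_left sum_distrib_right ac_simps)

lemma conj_by_scaleR: "conj_by u (c *\<^sub>R x) = c *\<^sub>R conj_by u x"
  by (simp add: vec_eq_iff conj_by_def matrix_matrix_mult_def scaleR_sum_right sum_distrib_right)

lemma star_automorphism_conj_by:
  assumes "unitary u"
  shows "star_automorphism (conj_by u)"
proof -
  have "unitary (dagger u)"
    using unitary_right [OF assms] by (simp add: unitary_def dagger_dagger)
  then have "conj_by u (conj_by (dagger u) x) = x" for x
    using conj_by_cancel [of "dagger u"] by (simp add: dagger_dagger)
  then have "bij (conj_by u)"
    by (metis assms bijI' conj_by_cancel)
  moreover have "conj_by u x ** conj_by u y = conj_by u (x ** y)" for x y
  proof -
    have "conj_by u x ** conj_by u y = u ** x ** (dagger u ** u) ** y ** dagger u"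
      by (simp add: conj_by_def matrix_mul_assoc)
    also have "\<dots> = conj_by u (x ** y)"
      unfolding assms [unfolded unitary_def] by (simp add: conj_by_def matrix_mul_assoc)
    finally show ?thesis .
  qed
  moreover have "conj_by u (dagger x) = dagger (conj_by u x)" for x
    by (simp add: conj_by_def dagger_mult dagger_dagger matrix_mul_assoc)
  ultimately show ?thesis
    by (simp add: star_automorphism_def conj_by_add conj_by_map)
qed

text \<open>
  Conjugation carries \<open>\<xi> \<otimes> \<xi>\<^sup>*\<close> to \<open>u \<xi> u\<^sup>\<dagger> \<otimes> (u \<xi> u\<^sup>\<dagger>)\<^sup>*\<close>: rotating the matrices that span the range of an edge
  projection yields an isomorphic quantum graph.
\<close>
lemma conj_by_tensor_conj:
  assumes "unitary u"
  shows "conj_by u (tensor_conj \<xi> x) = tensor_conj (conj_by u \<xi>) (conj_by u x)"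
proof -
  have "conj_by u \<xi> ** conj_by u x ** dagger (conj_by u \<xi>) =
    u ** \<xi> ** (dagger u ** u) ** x ** (dagger u ** u) ** dagger \<xi> ** dagger u"
    by (simp add: conj_by_def dagger_mult dagger_dagger matrix_mul_assoc)
  then show ?thesis
    using assms by (simp add: tensor_conj_eq unitary_def) (simp add: conj_by_def matrix_mul_assoc)
qed

lemma inner_conj_by:
  fixes x y :: "complex^'n^'n"
  assumes "unitary u"
  shows "conj_by u x \<bullet> conj_by u y = x \<bullet> y"
proof -
  have "l2_inner (conj_by u x) (conj_by u y) =
      of_nat CARD('n) * trace (u ** dagger x ** (dagger u ** u) ** y ** dagger u)"
    by (simp add: l2_inner_def conj_by_def dagger_mult dagger_dagger matrix_mul_assoc)
  also have "\<dots> = of_nat CARD('n) * trace (u ** (dagger x ** y ** dagger u))"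
    using assms by (simp add: unitary_def matrix_mul_assoc)
  also have "\<dots> = of_nat CARD('n) * trace (dagger x ** y ** (dagger u ** u))"
    by (subst trace_mul_sym) (simp add: matrix_mul_assoc)
  also have "\<dots> = l2_inner x y"
    using assms by (simp add: unitary_def l2_inner_def)
  finally have "Re (l2_inner (conj_by u x) (conj_by u y)) = Re (l2_inner x y)"
    by simp
  then show ?thesis
    by (simp add: l2_inner_Re)
qed

section \<open>Rotations of the traceless Hermitian two-by-two matrices\<close>

text \<open>The copy of \<open>\<real>\<^sup>3\<close> whose orthogonal axes are the Pauli matrices.\<close>
definition traceless_hermitian :: "(complex^2^2) set" where
  "traceless_hermitian = {x. dagger x = x \<and> trace x = 0}"

lemma traceless_hermitianE:
  assumes "x \<in> traceless_hermitian"
  obtains r z where "x $ 1 $ 1 = of_real r" "x $ 1 $ 2 = z" "x $ 2 $ 1 = cnj z" "x $ 2 $ 2 = - of_real r"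
proof -
  have "x $ 1 $ 1 = of_real (Re (x $ 1 $ 1))" "x $ 2 $ 1 = cnj (x $ 1 $ 2)" "x $ 1 $ 1 + x $ 2 $ 2 = 0"
    using assms hermitian_nth [of x 1 1] hermitian_nth [of x 1 2]
    by (auto simp: traceless_hermitian_def trace_def sum_2 complex_eq_iff)
  then show ?thesis
    using that [of "Re (x $ 1 $ 1)" "x $ 1 $ 2"] by (metis add_eq_0_iff)
qed

lemma subspace_traceless_hermitian: "subspace traceless_hermitian"
proof -
  have "trace (c *\<^sub>R x) = c *\<^sub>R trace x" for c and x :: "complex^2^2"
    by (simp add: trace_def scaleR_sum_right)
  then show ?thesis
    by (auto simp: subspace_def traceless_hermitian_def trace_add trace_0 [unfolded mat_0] dagger_def vec_eq_iff)
qed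

text \<open>
  Polarization of \<open>x\<^sup>2 = |x|\<^sup>2/2\<close>, which holds because a traceless Hermitian two-by-two matrix has
  eigenvalues \<open>\<plusminus>|x|/\<surd>2\<close>.  It reduces products of such matrices to inner products.
\<close>
lemma clifford:
  assumes "x \<in> traceless_hermitian" "y \<in> traceless_hermitian"
  shows "x ** y + y ** x = (x \<bullet> y) *\<^sub>R mat 1"
proof -
  obtain r z where x: "x $ 1 $ 1 = of_real r" "x $ 1 $ 2 = z" "x $ 2 $ 1 = cnj z" "x $ 2 $ 2 = - of_real r"
    using assms(1) by (rule traceless_hermitianE)
  obtain s w where y: "y $ 1 $ 1 = of_real s" "y $ 1 $ 2 = w" "y $ 2 $ 1 = cnj w" "y $ 2 $ 2 = - of_real s"
    using assms(2) by (rule traceless_hermitianE)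
  show ?thesis
    by (simp add: vec_eq_iff forall_2 matrix_matrix_mult_def sum_2 x y inner_vec_def inner_complex_def
        mat_def complex_eq_iff algebra_simps)
qed

text \<open>
  The Clifford relation gives \<open>n x n = (n \<bullet> x) n - x n n\<close>, and the normalization \<open>n \<bullet> n = 2\<close> means
  \<open>n n = 1\<close>.  Geometrically, conjugation by \<open>n\<close> is the half turn about the axis \<open>n\<close>.
\<close>
lemma half_turn:
  assumes n: "n \<in> traceless_hermitian" "n \<bullet> n = 2"
  shows "unitary n"
    and "\<And>x. x \<in> traceless_hermitian \<Longrightarrow> conj_by n x = (n \<bullet> x) *\<^sub>R n - x"
proof -
  have n': "dagger n = n"
    using n by (simp add: traceless_hermitian_def)
  have "2 *\<^sub>R (n ** n) = 2 *\<^sub>R mat 1"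
    using clifford [OF n(1) n(1)] n(2) by (simp add: scaleR_2)
  then have sq: "n ** n = mat 1"
    by simp
  then show "unitary n"
    by (simp add: unitary_def n')
  fix x assume x: "x \<in> traceless_hermitian"
  have "(n ** x + x ** n) ** n = (n \<bullet> x) *\<^sub>R n"
    unfolding clifford [OF n(1) x]
    by (simp add: vec_eq_iff matrix_matrix_mult_def mat_def if_distrib [of "\<lambda>x. _ *\<^sub>R x"]
        if_distrib [of "\<lambda>x. x * _"] cong: if_cong)
  then have "conj_by n x + x = (n \<bullet> x) *\<^sub>R n"
    by (simp add: conj_by_def n' matrix_add_rdistrib matrix_mul_assoc [symmetric] sq)
  then show "conj_by n x = (n \<bullet> x) *\<^sub>R n - x"
    by (simp add: algebra_simps)
qed

lemma conj_by_traceless_hermitian: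
  assumes "unitary u" "x \<in> traceless_hermitian"
  shows "conj_by u x \<in> traceless_hermitian"
proof -
  have "trace (conj_by u x) = trace (dagger u ** u ** x)"
    unfolding conj_by_def by (subst trace_mul_sym) (simp add: matrix_mul_assoc)
  then show ?thesis
    using assms by (simp add: traceless_hermitian_def unitary_def)
      (simp add: conj_by_def dagger_mult dagger_dagger matrix_mul_assoc)
qed

text \<open>The Pauli matrices and the identity have norm \<open>\<surd>2\<close>; this rescales them to unit vectors.\<close>
definition pauli_unit :: "complex^2^2 \<Rightarrow> complex^2^2" where
  "pauli_unit x = (1 / sqrt 2) *\<^sub>R x"

lemmas pauli_defs = pauli1_def pauli2_def pauli3_def

lemma pauli_inner:
  "pauli1 \<bullet> pauli1 = 2" "pauli2 \<bullet> pauli2 = 2" "pauli3 \<bullet> pauli3 = 2"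
  "pauli1 \<bullet> pauli2 = 0" "pauli1 \<bullet> pauli3 = 0" "pauli2 \<bullet> pauli3 = 0"
  "pauli2 \<bullet> pauli1 = 0" "pauli3 \<bullet> pauli1 = 0" "pauli3 \<bullet> pauli2 = 0"
  "mat 1 \<bullet> pauli1 = 0" "mat 1 \<bullet> pauli2 = 0" "mat 1 \<bullet> pauli3 = 0"
  "pauli1 \<bullet> mat 1 = 0" "pauli2 \<bullet> mat 1 = 0" "pauli3 \<bullet> mat 1 = 0" "(mat 1 :: complex^2^2) \<bullet> mat 1 = 2"
  by (simp_all add: inner_vec_def sum_2 pauli_defs mat_def)

lemma pauli_traceless_hermitian:
  "pauli1 \<in> traceless_hermitian" "pauli2 \<in> traceless_hermitian" "pauli3 \<in> traceless_hermitian"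
  by (simp_all add: traceless_hermitian_def trace_def sum_2 pauli_defs vec_eq_iff forall_2 dagger_def)

lemma inner_mat_1: "x \<bullet> mat 1 = Re (trace x)" for x :: "complex^2^2"
  by (simp add: inner_vec_def sum_2 mat_def trace_def)

lemma dim_hermitian: "dim {x :: complex^2^2. dagger x = x} \<le> 4"
proof -
  have "x \<in> span {mat 1, pauli1, pauli2, pauli3}" if "dagger x = x" for x :: "complex^2^2"
  proof -
    have h: "cnj (x $ i $ j) = x $ j $ i" for i j
      by (rule hermitian_nth [OF that])
    have "x = (Re (x $ 1 $ 1 + x $ 2 $ 2) / 2) *\<^sub>R mat 1 + (Re (x $ 1 $ 2) *\<^sub>R pauli1
        + ((- Im (x $ 1 $ 2)) *\<^sub>R pauli2 + (Re (x $ 1 $ 1 - x $ 2 $ 2) / 2) *\<^sub>R pauli3))"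
      using h [of 1 1] h [of 1 2] h [of 2 2]
      by (auto simp: vec_eq_iff forall_2 mat_def pauli_defs complex_eq_iff field_simps)
    also have "\<dots> \<in> span {mat 1, pauli1, pauli2, pauli3}"
      by (intro span_add span_scale span_base) auto
    finally show ?thesis .
  qed
  then have "dim {x :: complex^2^2. dagger x = x} \<le> card {mat 1, pauli1, pauli2, pauli3}"
    by (intro dim_le_card) auto
  also have "\<dots> \<le> 4"
    by (simp add: card_insert_if)
  finally show ?thesis .
qed

text \<open>Two vectors cannot span the three-dimensional space of traceless Hermitian matrices.\<close>
lemma orthogonal_traceless_hermitian_exists:
  assumes "B \<subseteq> traceless_hermitian" "finite B" "card B \<le> 2"
  obtains a where "a \<in> traceless_hermitian" "norm a = 1" "\<And>b. b \<in> B \<Longrightarrow> a \<bullet> b = 0"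
proof -
  have "pairwise orthogonal {pauli1, pauli2, pauli3}"
    by (auto simp: pairwise_insert orthogonal_def pauli_inner)
  moreover have "0 \<notin> {pauli1, pauli2, pauli3}"
    using pauli_inner(1-3) by auto
  ultimately have "independent {pauli1, pauli2, pauli3}"
    by (rule pairwise_orthogonal_independent)
  moreover have "card {pauli1, pauli2, pauli3} = 3"
    using pauli_inner by (auto simp: card_insert_if)
  ultimately have "3 \<le> dim traceless_hermitian"
    using independent_card_le_dim [of "{pauli1, pauli2, pauli3}" traceless_hermitian]
      pauli_traceless_hermitian by simp
  moreover have "dim B \<le> 2"
    using assms dim_le_card' [of B] by simp
  ultimately have "span B \<noteq> traceless_hermitian"
    using dim_span [of B] by (auto simp del: dim_span)
  moreover have "span B \<subseteq> traceless_hermitian"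
    using assms(1) subspace_traceless_hermitian by (rule span_minimal)
  moreover have sp: "span traceless_hermitian = traceless_hermitian"
    using subspace_traceless_hermitian by (simp add: span_eq_iff)
  ultimately have "span B \<subset> span traceless_hermitian"
    unfolding sp by (simp add: psubset_eq)
  then obtain x where x: "x \<noteq> 0" "x \<in> traceless_hermitian" "\<And>y. y \<in> span B \<Longrightarrow> orthogonal x y"
    using orthogonal_to_subspace_exists_gen sp by metis
  show ?thesis
  proof
    show "(1 / norm x) *\<^sub>R x \<in> traceless_hermitian"
      using x subspace_traceless_hermitian by (intro subspace_scale)
    show "norm ((1 / norm x) *\<^sub>R x) = 1"
      using x by simp
    show "(1 / norm x) *\<^sub>R x \<bullet> b = 0" if "b \<in> B" for b
      using x(3) [OF span_base [OF that]] by (simp add: orthogonal_def)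
  qed
qed

text \<open>
  The half turn about \<open>n\<close> reflects a vector in the line of \<open>n\<close>, and \<open>a\<close>, \<open>b\<close> are mirror images in
  their bisector because they have the same length.
\<close>
lemma half_turn_bisector:
  assumes "a \<in> traceless_hermitian" "norm a = 1" "b \<in> traceless_hermitian" "norm b = 1" "a + b \<noteq> 0"
  defines "n \<equiv> (sqrt 2 / norm (a + b)) *\<^sub>R (a + b)"
  shows "n \<in> traceless_hermitian" "n \<bullet> n = 2" "conj_by n a = b"
proof -
  show n: "n \<in> traceless_hermitian"
    unfolding n_def using assms subspace_traceless_hermitian by (intro subspace_scale subspace_add)
  have pos: "norm (a + b) > 0"
    using assms by simp
  have sq: "(norm (a + b))\<^sup>2 = 2 * ((a + b) \<bullet> a)"
    using assms by (simp add: power2_norm_eq_inner norm_eq_1 inner_commute algebra_simps)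
  show nn: "n \<bullet> n = 2"
    using pos by (simp add: n_def power2_norm_eq_inner [symmetric] power2_eq_square)
  have "(n \<bullet> a) *\<^sub>R n = (2 * ((a + b) \<bullet> a) / (norm (a + b))\<^sup>2) *\<^sub>R (a + b)"
    by (simp add: n_def power2_eq_square)
  also have "\<dots> = a + b"
    using pos unfolding sq [symmetric] by simp
  finally show "conj_by n a = b"
    using half_turn(2) [OF n nn assms(1)] by simp
qed

text \<open>Opposite vectors have no bisector; for them any axis orthogonal to both serves.\<close>
lemma half_turn_exists:
  assumes "a \<in> traceless_hermitian" "norm a = 1" "b \<in> traceless_hermitian" "norm b = 1"
  obtains n where "n \<in> traceless_hermitian" "n \<bullet> n = 2" "conj_by n a = b"
proof (cases "a + b = 0")
  case False
  then show ?thesis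
    using half_turn_bisector [OF assms] that by blast
next
  case True
  obtain c where c: "c \<in> traceless_hermitian" "norm c = 1" "c \<bullet> a = 0"
    using orthogonal_traceless_hermitian_exists [of "{a}"] assms by auto
  let ?n = "sqrt 2 *\<^sub>R c"
  have n: "?n \<in> traceless_hermitian" "?n \<bullet> ?n = 2"
    using c by (auto intro!: subspace_scale [OF subspace_traceless_hermitian] simp: norm_eq_1)
  moreover have "conj_by ?n a = b"
    using half_turn(2) [OF n assms(1)] c True by (simp add: add_eq_0_iff2)
  ultimately show ?thesis
    by (rule that)
qed

text \<open>
  A half turn brings \<open>a\<close> to \<open>a'\<close> and leaves \<open>b\<close> at some \<open>d\<close> orthogonal to \<open>a'\<close>.  The half turn about the
  bisector of \<open>d\<close> and \<open>b'\<close> then brings \<open>d\<close> to \<open>b'\<close>, but its axis is orthogonal to \<open>a'\<close>, so it reverses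
  \<open>a'\<close>; the half turn about \<open>b'\<close> restores \<open>a'\<close>.  If \<open>d = -b'\<close>, the half turn about \<open>a'\<close> suffices.
\<close>
lemma frame_rotation:
  assumes "a \<in> traceless_hermitian" "norm a = 1" "b \<in> traceless_hermitian" "norm b = 1" "a \<bullet> b = 0"
    and "a' \<in> traceless_hermitian" "norm a' = 1" "b' \<in> traceless_hermitian" "norm b' = 1" "a' \<bullet> b' = 0"
  obtains u where "unitary u" "conj_by u a = a'" "conj_by u b = b'"
proof -
  obtain n where n: "n \<in> traceless_hermitian" "n \<bullet> n = 2" "conj_by n a = a'"
    using half_turn_exists assms by metis
  define d where "d = conj_by n b"
  note un = half_turn(1) [OF n(1,2)]
  have d: "d \<in> traceless_hermitian" "norm d = 1" "d \<bullet> a' = 0"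
    using conj_by_traceless_hermitian [OF un] inner_conj_by [OF un] assms
    by (auto simp: d_def n(3) [symmetric] norm_eq_1 inner_commute)
  have scaled: "sqrt 2 *\<^sub>R x \<in> traceless_hermitian" "sqrt 2 *\<^sub>R x \<bullet> sqrt 2 *\<^sub>R x = 2"
    "conj_by (sqrt 2 *\<^sub>R x) y = 2 *\<^sub>R (x \<bullet> y) *\<^sub>R x - y"
    if "x \<in> traceless_hermitian" "norm x = 1" "y \<in> traceless_hermitian" for x y
  proof -
    show 1: "sqrt 2 *\<^sub>R x \<in> traceless_hermitian"
      using subspace_traceless_hermitian that by (intro subspace_scale)
    show 2: "sqrt 2 *\<^sub>R x \<bullet> sqrt 2 *\<^sub>R x = 2"
      using that by (simp add: norm_eq_1)
    show "conj_by (sqrt 2 *\<^sub>R x) y = 2 *\<^sub>R (x \<bullet> y) *\<^sub>R x - y"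
      using half_turn(2) [OF 1 2 that(3)] by simp
  qed
  have "\<exists>v. unitary v \<and> conj_by v a' = a' \<and> conj_by v d = b'"
  proof (cases "d + b' = 0")
    case True
    let ?v = "sqrt 2 *\<^sub>R a'"
    have "unitary ?v" "conj_by ?v a' = a'" "conj_by ?v d = b'"
      using half_turn(1) scaled [OF assms(6,7)] assms d True
      by (auto simp: norm_eq_1 inner_commute scaleR_2 add_eq_0_iff2)
    then show ?thesis by blast
  next
    case False
    let ?p = "(sqrt 2 / norm (d + b')) *\<^sub>R (d + b')" and ?q = "sqrt 2 *\<^sub>R b'"
    note p = half_turn_bisector [OF d(1,2) assms(8,9) False]
    have "?p \<bullet> a' = 0"
      using d assms by (simp add: inner_add_left inner_add_right inner_commute)
    then have "conj_by ?p a' = - a'"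
      using half_turn(2) [OF p(1,2) assms(6)] by simp
    moreover have "conj_by ?q (- a') = a'"
      using scaled(3) [OF assms(8,9), of "- a'"] assms(6,10) subspace_traceless_hermitian
      by (simp add: subspace_neg inner_commute)
    moreover have "conj_by ?q b' = b'"
      using scaled(3) [OF assms(8,9,8)] assms by (simp add: norm_eq_1 scaleR_2)
    ultimately have "unitary (?q ** ?p)" "conj_by (?q ** ?p) a' = a'" "conj_by (?q ** ?p) d = b'"
      using half_turn(1) [OF p(1,2)] half_turn(1) [OF scaled(1,2)] assms(8,9) p(3)
      by (auto simp: conj_by_mult unitary_mult)
    then show ?thesis by blast
  qed
  then obtain v where "unitary v" "conj_by v a' = a'" "conj_by v d = b'"
    by blast
  then have "unitary (v ** n)" "conj_by (v ** n) a = a'" "conj_by (v ** n) b = b'"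
    using un by (auto simp: conj_by_mult unitary_mult n(3) d_def)
  then show ?thesis
    by (rule that)
qed

text \<open>
  After two frame vectors lie on their axes, the third is on the remaining one up to a sign, to which
  \<open>\<xi> \<otimes> \<xi>\<^sup>*\<close> is insensitive.
\<close>
lemma third_axis:
  assumes "x \<in> traceless_hermitian" "norm x = 1" "x \<bullet> pauli2 = 0" "x \<bullet> pauli3 = 0"
  obtains r where "x = r *\<^sub>R pauli1" "r\<^sup>2 = 1 / 2"
proof -
  obtain r z where x: "x $ 1 $ 1 = of_real r" "x $ 1 $ 2 = z" "x $ 2 $ 1 = cnj z" "x $ 2 $ 2 = - of_real r"
    using assms(1) by (rule traceless_hermitianE)
  have "Im z = 0" "r = 0"
    using assms(3,4) by (simp_all add: inner_vec_def sum_2 pauli_defs x inner_complex_def)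
  then have *: "x = Re z *\<^sub>R pauli1"
    by (simp add: vec_eq_iff forall_2 x pauli_defs complex_eq_iff)
  moreover have "(Re z)\<^sup>2 = 1 / 2"
    using assms(2) unfolding norm_eq_1 by (subst (asm) (1 2) *) (simp add: pauli_inner power2_eq_square)
  ultimately show ?thesis
    by (rule that)
qed

section \<open>The families are undirected quantum graphs\<close>

lemma tensor_conj_scaleR: "tensor_conj (r *\<^sub>R \<xi>) x = r\<^sup>2 *\<^sub>R tensor_conj \<xi> x"
  by (simp add: tensor_conj_def vec_eq_iff scaleR_sum_right power2_eq_square)

text \<open>The factor \<open>n = 2\<close> in the adjacency matrix cancels the normalization of the Pauli matrices.\<close>
lemma adjacency_edge_proj_pauli_unit:
  "adjacency (edge_proj (pauli_unit ` X)) x = (\<Sum>\<xi>\<in>X. tensor_conj \<xi> x)"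
proof -
  have "inj_on pauli_unit X"
    by (simp add: inj_on_def pauli_unit_def)
  then have "adjacency (edge_proj (pauli_unit ` X)) x = 2 *\<^sub>R (\<Sum>\<xi>\<in>X. tensor_conj (pauli_unit \<xi>) x)"
    by (simp add: adjacency_edge_proj sum.reindex)
  then show ?thesis
    by (simp add: pauli_unit_def tensor_conj_scaleR power_divide scaleR_sum_right)
qed

lemma pauli3_t_inner:
  "pauli3_t t \<bullet> pauli3_t t = 2" "pauli3_t t \<bullet> pauli1 = 0" "pauli3_t t \<bullet> pauli2 = 0"
  "pauli1 \<bullet> pauli3_t t = 0" "pauli2 \<bullet> pauli3_t t = 0"
proof -
  have "2 * (sin t)\<^sup>2 + 2 * (cos t)\<^sup>2 = 2"
    using sin_cos_squared_add [of t] by linarith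
  then show "pauli3_t t \<bullet> pauli3_t t = 2"
    by (simp add: pauli3_t_def inner_add_left inner_add_right pauli_inner power2_eq_square)
qed (simp_all add: pauli3_t_def inner_add_left inner_add_right pauli_inner)

lemma family_realized:
  assumes m: "m \<in> {1, 2, 3}"
  shows "\<exists>E :: complex^(2 \<times> 2)^(2 \<times> 2).
    quantum_graph E \<and> undirected E \<and> rank E = m \<and> adjacency E = family_adj m t"
proof -
  define X where "X = (if m = 1 then {pauli3_t t} else if m = 2 then {pauli3_t t, pauli2}
    else {pauli3_t t, pauli2, pauli1})"
  have ne: "pauli3_t t \<noteq> pauli2" "pauli3_t t \<noteq> pauli1" "pauli2 \<noteq> pauli1"
    using pauli_inner pauli3_t_inner [of t] by auto
  have card: "card X = m"
    using m ne by (auto simp: X_def)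
  have X: "X \<subseteq> {pauli3_t t, pauli2, pauli1}"
    by (auto simp: X_def)
  have "dagger \<xi> = \<xi> \<and> \<xi> \<bullet> \<xi> = 2" if "\<xi> \<in> X" for \<xi>
    using that X pauli_traceless_hermitian(1,2) pauli_inner pauli3_t_inner [of t]
    by (auto simp: traceless_hermitian_def)
      (auto simp: dagger_def pauli3_t_def pauli3_def mat_def vec_eq_iff forall_2)
  moreover have "pairwise orthogonal {pauli3_t t, pauli2, pauli1}"
    by (auto simp: pairwise_insert orthogonal_def pauli_inner pauli3_t_inner)
  then have "pairwise orthogonal X"
    using X by (rule pairwise_subset)
  moreover have "finite X"
    using X by (rule finite_subset) simp
  ultimately have "hermitian_orthonormal (pauli_unit ` X)"
    by (auto simp: hermitian_orthonormal_def pairwise_def orthogonal_def pauli_unit_def norm_eq_1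
        dagger_scaleR)
  moreover have "card (pauli_unit ` X) = m"
    using card by (subst card_image) (auto simp: inj_on_def pauli_unit_def)
  moreover have "adjacency (edge_proj (pauli_unit ` X)) = family_adj m t"
    using m ne by (auto simp: fun_eq_iff adjacency_edge_proj_pauli_unit family_adj_def X_def add.assoc)
  ultimately show ?thesis
    using quantum_graph_edge_proj undirected_edge_proj rank_edge_proj by metis
qed

section \<open>Normal forms of undirected quantum graphs\<close>

text \<open>
  Take \<open>u\<close> along the orthogonal projection \<open>y\<close> of \<open>e\<close> onto \<open>S\<close>, or arbitrary in \<open>S\<close> if \<open>y\<close> vanishes: vectors
  of \<open>S\<close> that are orthogonal to \<open>u\<close> are then orthogonal to \<open>e\<close>.  With \<open>e\<close> the identity matrix, all
  basis elements except one become traceless.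
\<close>
lemma orthonormal_basis_adapted:
  fixes S :: "'a::euclidean_space set"
  assumes "subspace S" "S \<noteq> {0}"
  obtains u B where "u \<notin> B" "finite B" "pairwise orthogonal (insert u B)"
    "\<And>b. b \<in> insert u B \<Longrightarrow> norm b = 1" "span (insert u B) = S"
    "\<And>b. b \<in> B \<Longrightarrow> b \<bullet> e = 0"
proof -
  obtain y z where yz: "y \<in> span S" "\<And>w. w \<in> span S \<Longrightarrow> orthogonal z w" "e = y + z"
    using orthogonal_subspace_decomp_exists by blast
  have sp: "span S = S" using assms by (simp add: span_eq_iff)
  obtain x0 where x0: "x0 \<in> S" "x0 \<noteq> 0"
    using assms subspace_0 by blast
  define x where "x = (if y = 0 then x0 else y)"
  define u where "u = (1 / norm x) *\<^sub>R x"
  (* In either case y is a multiple of x, so orthogonality to u implies orthogonality to y. *)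
  have x: "x \<in> S" "x \<noteq> 0" "y = (if y = 0 then 0 else 1) *\<^sub>R x"
    using x0 yz sp by (auto simp: x_def)
  have u: "u \<in> S" "norm u = 1"
    using x assms by (auto simp: u_def intro: subspace_scale)
  define S' where "S' = {b \<in> S. b \<bullet> u = 0}"
  have "subspace S'"
    using assms(1) by (auto simp: S'_def subspace_def inner_add_left)
  then obtain B where B: "B \<subseteq> S'" "pairwise orthogonal B" "\<And>b. b \<in> B \<Longrightarrow> norm b = 1"
      "independent B" "span B = S'"
    by (rule orthonormal_basis_subspace) blast
  have Bu: "b \<bullet> u = 0" if "b \<in> B" for b
    using that B(1) by (auto simp: S'_def)
  show ?thesis
  proof (rule that [of u B])
    show "u \<notin> B"
      using Bu u by (auto simp: norm_eq_1)
    show "finite B"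
      using B(4) by (rule independent_imp_finite)
    show "pairwise orthogonal (insert u B)"
      using B(2) Bu by (auto simp: pairwise_insert orthogonal_def inner_commute)
    show "norm b = 1" if "b \<in> insert u B" for b
      using that u B(3) by auto
    show "span (insert u B) = S"
    proof
      show "span (insert u B) \<subseteq> S"
        using u B(1) assms(1) by (intro span_minimal) (auto simp: S'_def)
      show "S \<subseteq> span (insert u B)"
      proof
        fix s assume "s \<in> S"
        then have "s - (s \<bullet> u) *\<^sub>R u \<in> span B"
          unfolding B(5) S'_def using u assms(1)
          by (auto simp: inner_diff_left norm_eq_1 intro!: subspace_diff subspace_scale)
        then show "s \<in> span (insert u B)"
          unfolding span_insert by blast
      qed
    qed
    show "b \<bullet> e = 0" if "b \<in> B" for b
    proof -
      have "b \<bullet> x = 0" using Bu [OF that] x by (simp add: u_def)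
      then have "b \<bullet> y = 0" by (subst x(3)) simp
      moreover have "b \<bullet> z = 0"
        using B(1) that yz(2) [of b] sp by (auto simp: S'_def orthogonal_def inner_commute)
      ultimately show ?thesis by (simp add: yz(3) inner_add_right)
    qed
  qed
qed

text \<open>
  The coordinates of \<open>u\<close> along the identity and along its traceless part lie on the unit circle.
  Their signs are absorbed into the overall sign \<open>\<epsilon>\<close> and into the direction \<open>a\<close>, which puts the angle
  in the first quadrant.  When \<open>u\<close> has no traceless part, \<open>a\<close> may be any direction orthogonal to \<open>B\<close>,
  which exists because \<open>B\<close> has at most two elements.
\<close>
lemma polar_form:
  assumes B: "finite B" "B \<subseteq> traceless_hermitian" "card B \<le> 2"
    and u: "dagger u = u" "norm u = 1" "\<And>b. b \<in> B \<Longrightarrow> u \<bullet> b = 0"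
  obtains t a \<epsilon> where "t \<in> {0..pi/2}" "a \<in> traceless_hermitian" "norm a = 1"
    "\<And>b. b \<in> B \<Longrightarrow> a \<bullet> b = 0" "\<epsilon>\<^sup>2 = 1"
    "u = \<epsilon> *\<^sub>R (cos t *\<^sub>R pauli_unit (mat 1) + sin t *\<^sub>R a)"
proof -
  define e where "e = pauli_unit (mat 1)"
  define c where "c = u \<bullet> e"
  define v where "v = u - c *\<^sub>R e"
  have ee: "e \<bullet> e = 1"
    by (simp add: e_def pauli_unit_def pauli_inner)
  have T: "x \<in> traceless_hermitian \<longleftrightarrow> dagger x = x \<and> x \<bullet> e = 0" for x
  proof (cases "dagger x = x")
    case True
    then have "Im (x $ 1 $ 1) = 0" "Im (x $ 2 $ 2) = 0"
      using hermitian_nth [of x 1 1] hermitian_nth [of x 2 2] by (auto simp: complex_eq_iff)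
    then have "trace x = 0 \<longleftrightarrow> Re (trace x) = 0"
      by (simp add: trace_def sum_2 complex_eq_iff)
    then show ?thesis
      using True by (simp add: traceless_hermitian_def e_def pauli_unit_def inner_mat_1)
  qed (simp add: traceless_hermitian_def)
  have "dagger e = e"
    by (simp add: e_def pauli_unit_def dagger_def mat_def vec_eq_iff)
  then have "dagger v = v"
    using u(1) by (simp add: v_def dagger_def vec_eq_iff)
  then have v: "v \<in> traceless_hermitian"
    unfolding T by (simp add: v_def c_def inner_diff_left ee)
  have vB: "v \<bullet> b = 0" if "b \<in> B" for b
    using that B(2) u(3) T [of b] by (auto simp: v_def inner_diff_left inner_commute [of e b])
  have "\<exists>a s. a \<in> traceless_hermitian \<and> norm a = 1 \<and> (\<forall>b\<in>B. a \<bullet> b = 0) \<and> v = s *\<^sub>R a"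
  proof (cases "v = 0")
    case True
    obtain a where "a \<in> traceless_hermitian" "norm a = 1" "\<And>b. b \<in> B \<Longrightarrow> a \<bullet> b = 0"
      using orthogonal_traceless_hermitian_exists B by blast
    then show ?thesis
      using True by (intro exI [of _ a] exI [of _ 0]) auto
  next
    case False
    then show ?thesis
      using v vB subspace_scale [OF subspace_traceless_hermitian v, of "1 / norm v"]
      by (intro exI [of _ "(1 / norm v) *\<^sub>R v"] exI [of _ "norm v"]) auto
  qed
  then obtain a s where a: "a \<in> traceless_hermitian" "norm a = 1" "\<And>b. b \<in> B \<Longrightarrow> a \<bullet> b = 0"
    and "v = s *\<^sub>R a"
    by blast
  then have ucs: "u = c *\<^sub>R e + s *\<^sub>R a"
    by (simp add: v_def algebra_simps)
  have "a \<bullet> e = 0" "e \<bullet> a = 0"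
    using a(1) T by (auto simp: inner_commute [of e a])
  then have "\<bar>c\<bar>\<^sup>2 + \<bar>s\<bar>\<^sup>2 = u \<bullet> u"
    using a(2) ee unfolding ucs
    by (simp add: inner_add_left inner_add_right norm_eq_1 power2_eq_square)
  also have "\<dots> = 1"
    using u(2) by (simp add: norm_eq_1)
  finally obtain t where t: "0 \<le> t" "t \<le> pi/2" "\<bar>c\<bar> = cos t" "\<bar>s\<bar> = sin t"
    using sincos_total_pi_half [of "\<bar>c\<bar>" "\<bar>s\<bar>"] by auto
  define \<epsilon> \<delta> where "\<epsilon> = (if c \<ge> 0 then 1 else - 1 :: real)" and "\<delta> = (if s \<ge> 0 then 1 else - 1 :: real)"
  show ?thesis
  proof
    show "t \<in> {0..pi/2}" using t by simp
    show "(\<epsilon> * \<delta>) *\<^sub>R a \<in> traceless_hermitian"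
      using a(1) subspace_traceless_hermitian by (intro subspace_scale)
    show "norm ((\<epsilon> * \<delta>) *\<^sub>R a) = 1"
      using a(2) by (simp add: \<epsilon>_def \<delta>_def)
    show "(\<epsilon> * \<delta>) *\<^sub>R a \<bullet> b = 0" if "b \<in> B" for b
      using a(3) that by simp
    show "\<epsilon>\<^sup>2 = 1"
      by (simp add: \<epsilon>_def)
    show "u = \<epsilon> *\<^sub>R (cos t *\<^sub>R pauli_unit (mat 1) + sin t *\<^sub>R (\<epsilon> * \<delta>) *\<^sub>R a)"
      using t(3,4) unfolding ucs e_def [symmetric] t(3,4) [symmetric]
      by (simp add: \<epsilon>_def \<delta>_def scaleR_add_right)
  qed
qed

text \<open>
  With \<open>u\<close> in polar form, rotate \<open>a\<close> to the third axis and one member of \<open>B\<close> to the second; a further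
  member of \<open>B\<close> then lies on the first axis.
\<close>
lemma isomorphic_family:
  assumes ho: "hermitian_orthonormal (insert u B)" and "u \<notin> B"
    and B: "B \<subseteq> traceless_hermitian" "card B \<le> 2"
  shows "\<exists>m\<in>{1, 2, 3}. \<exists>t\<in>{0..pi/2}. isomorphic_adj (adjacency (edge_proj (insert u B))) (family_adj m t)"
proof -
  have fin: "finite B" and u: "dagger u = u" "norm u = 1" and Bu: "\<And>b. b \<in> B \<Longrightarrow> u \<bullet> b = 0"
    and B1: "\<And>b. b \<in> B \<Longrightarrow> norm b = 1"
    and BB: "\<And>b c. b \<in> B \<Longrightarrow> c \<in> B \<Longrightarrow> b \<noteq> c \<Longrightarrow> b \<bullet> c = 0"
    using ho \<open>u \<notin> B\<close> by (auto simp: hermitian_orthonormal_def pairwise_insert orthogonal_def pairwise_def)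
  obtain t a \<epsilon> where t: "t \<in> {0..pi/2}" and a: "a \<in> traceless_hermitian" "norm a = 1"
      "\<And>b. b \<in> B \<Longrightarrow> a \<bullet> b = 0" and \<epsilon>: "\<epsilon>\<^sup>2 = 1"
      and ut: "u = \<epsilon> *\<^sub>R (cos t *\<^sub>R pauli_unit (mat 1) + sin t *\<^sub>R a)"
    using polar_form [OF fin B u Bu] by metis
  (* If B is empty, an auxiliary vector b completes the frame that the rotation acts on. *)
  have "\<exists>b. b \<in> traceless_hermitian \<and> norm b = 1 \<and> a \<bullet> b = 0 \<and> (B \<noteq> {} \<longrightarrow> b \<in> B)"
  proof (cases "B = {}")
    case True
    obtain b where "b \<in> traceless_hermitian" "norm b = 1" "b \<bullet> a = 0"
      using orthogonal_traceless_hermitian_exists [of "{a}"] a by auto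
    then show ?thesis
      using True by (auto simp: inner_commute)
  next
    case False
    then show ?thesis
      using B B1 a(3) by blast
  qed
  then obtain b where b: "b \<in> traceless_hermitian" "norm b = 1" "a \<bullet> b = 0" "B \<noteq> {} \<longrightarrow> b \<in> B"
    by blast
  have pu: "pauli_unit pauli3 \<in> traceless_hermitian" "norm (pauli_unit pauli3) = 1"
     "pauli_unit pauli2 \<in> traceless_hermitian" "norm (pauli_unit pauli2) = 1"
     "pauli_unit pauli3 \<bullet> pauli_unit pauli2 = 0"
    by (auto simp: pauli_unit_def norm_eq_sqrt_inner pauli_inner
        intro!: subspace_scale [OF subspace_traceless_hermitian] pauli_traceless_hermitian)
  obtain w where w: "unitary w" "conj_by w a = pauli_unit pauli3" "conj_by w b = pauli_unit pauli2"
    using frame_rotation [OF a(1,2) b(1-3) pu] by metis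
  have we: "conj_by w (mat 1) = mat 1"
    using unitary_right [OF w(1)] by (simp add: conj_by_def)
  have wu: "conj_by w u = (\<epsilon> / sqrt 2) *\<^sub>R pauli3_t t"
    unfolding ut by (simp add: pauli_unit_def conj_by_add conj_by_scaleR we w(2) pauli3_t_def
        scaleR_add_right)
  have halves: "2 *\<^sub>R tensor_conj (conj_by w u) x = tensor_conj (pauli3_t t) x"
      "2 *\<^sub>R tensor_conj (conj_by w b) x = tensor_conj pauli2 x" for x
    using \<epsilon> by (simp_all add: wu w(3) pauli_unit_def tensor_conj_scaleR power_divide)
  have conj_adj: "conj_by w (adjacency (edge_proj (insert u B)) x) =
      2 *\<^sub>R tensor_conj (conj_by w u) (conj_by w x) + (\<Sum>c\<in>B. 2 *\<^sub>R tensor_conj (conj_by w c) (conj_by w x))" for x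
  proof -
    interpret additive "conj_by w"
      by unfold_locales (rule conj_by_add)
    show ?thesis
      using fin \<open>u \<notin> B\<close>
      by (simp add: adjacency_edge_proj conj_by_scaleR sum add conj_by_tensor_conj [OF w(1)]
          scaleR_add_right scaleR_sum_right)
  qed
  have iso: "isomorphic_adj (adjacency (edge_proj (insert u B))) F"
    if "\<And>x. F x = tensor_conj (pauli3_t t) x + (\<Sum>c\<in>B. 2 *\<^sub>R tensor_conj (conj_by w c) x)" for F
    unfolding isomorphic_adj_def
    by (intro exI [of _ "conj_by w"])
      (simp add: star_automorphism_conj_by [OF w(1)] fun_eq_iff conj_adj that halves)
  consider "B = {}" | "B = {b}" | c where "B = {b, c}" "b \<noteq> c"
  proof -
    have "card B = 0 \<or> card B = 1 \<or> card B = 2"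
      using B(2) by linarith
    then show ?thesis
      using that b(4) fin by (auto simp: card_1_singleton_iff card_2_iff)
  qed
  then show ?thesis
  proof cases
    case 1
    then have "isomorphic_adj (adjacency (edge_proj (insert u B))) (family_adj 1 t)"
      by (intro iso) (simp add: family_adj_def)
    then show ?thesis using t by blast
  next
    case 2
    then have "isomorphic_adj (adjacency (edge_proj (insert u B))) (family_adj 2 t)"
      by (intro iso) (simp add: family_adj_def halves)
    then show ?thesis using t by blast
  next
    case 3
    have c: "c \<in> traceless_hermitian" "norm c = 1" "c \<bullet> a = 0" "c \<bullet> b = 0"
      using 3 B B1 a(3) [of c] BB [of c b] by (auto simp: inner_commute [of c a])
    have "conj_by w c \<bullet> pauli_unit pauli2 = 0" "conj_by w c \<bullet> pauli_unit pauli3 = 0"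
      using c(3,4) inner_conj_by [OF w(1)] unfolding w(2,3) [symmetric] by auto
    then have "conj_by w c \<bullet> pauli2 = 0" "conj_by w c \<bullet> pauli3 = 0"
      by (simp_all add: pauli_unit_def)
    moreover have "conj_by w c \<in> traceless_hermitian" "norm (conj_by w c) = 1"
      using c(1,2) conj_by_traceless_hermitian [OF w(1)] inner_conj_by [OF w(1)] by (auto simp: norm_eq_1)
    ultimately obtain r where r: "conj_by w c = r *\<^sub>R pauli1" "r\<^sup>2 = 1 / 2"
      using third_axis by metis
    have "2 *\<^sub>R tensor_conj (conj_by w c) x = tensor_conj pauli1 x" for x
      by (simp only: r tensor_conj_scaleR) simp
    then have "isomorphic_adj (adjacency (edge_proj (insert u B))) (family_adj 3 t)"
      using 3 by (intro iso) (simp add: family_adj_def halves add.assoc)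
    then show ?thesis using t by blast
  qed
qed

text \<open>
  The real dimension of the space of Hermitian matrices in the range is between \<open>0\<close> and \<open>4\<close>.  The two
  extremes are the empty and the full graph; otherwise an adapted basis has at most two traceless
  elements besides \<open>u\<close>.
\<close>
lemma undirected_quantum_graph_classification:
  fixes E :: "complex^(2 \<times> 2)^(2 \<times> 2)"
  assumes E: "quantum_graph E" "undirected E"
  shows "(\<exists>m\<in>{1, 2, 3}. \<exists>t\<in>{0..pi/2}. isomorphic_adj (adjacency E) (family_adj m t)) \<or>
    adjacency E = (\<lambda>x. 0) \<or> E = tensor_op (mat 1) (mat 1)"
proof -
  let ?H = "{x :: complex^2^2. dagger x = x}"
  define S where "S = {x :: complex^2^2. dagger x = x \<and> E *v flat x = flat x}"
  have H: "subspace ?H"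
    by (auto simp: subspace_def dagger_def vec_eq_iff)
  have "S = ?H \<inter> {x. E *v flat x = flat x}"
    by (auto simp: S_def)
  then have S: "subspace S"
    using subspace_inter [OF H subspace_fixed] by simp
  show ?thesis
  proof (cases "S = {0}")
    case True
    have "E = edge_proj {}"
      using True by (intro edge_proj_eqI [OF E]) (auto simp: hermitian_orthonormal_def S_def)
    then have "adjacency E = (\<lambda>x. 0)"
      by (simp add: fun_eq_iff adjacency_edge_proj)
    then show ?thesis by blast
  next
    case False
    obtain u B where uB: "u \<notin> B" "finite B" "pairwise orthogonal (insert u B)"
      "\<And>b. b \<in> insert u B \<Longrightarrow> norm b = 1" "span (insert u B) = S" "\<And>b. b \<in> B \<Longrightarrow> b \<bullet> mat 1 = 0"
      using orthonormal_basis_adapted [OF S False] by metis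
    have herm: "dagger b = b" if "b \<in> insert u B" for b
      using span_base [OF that] unfolding uB(5) S_def by simp
    then have ho: "hermitian_orthonormal (insert u B)"
      using uB by (simp add: hermitian_orthonormal_def)
    show ?thesis
    proof (cases "card B \<le> 2")
      case True
      have "B \<subseteq> traceless_hermitian"
      proof
        fix b assume b: "b \<in> B"
        then have "Re (trace b) = 0" "dagger b = b"
          using uB(6) herm by (auto simp: inner_mat_1)
        then show "b \<in> traceless_hermitian"
          using hermitian_nth [of b 1 1] hermitian_nth [of b 2 2]
          by (simp add: traceless_hermitian_def trace_def sum_2 complex_eq_iff)
      qed
      moreover have "E = edge_proj (insert u B)"
        using uB(5) by (intro edge_proj_eqI [OF E ho]) (simp add: S_def)
      ultimately show ?thesis
        using isomorphic_family [OF ho uB(1) _ True] by simp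
    next
      case False
      have "0 \<notin> insert u B"
        using uB(4) by fastforce
      then have "independent (insert u B)"
        by (rule pairwise_orthogonal_independent [OF uB(3)])
      then have "dim S = card (insert u B)"
        using uB(5) dim_span_eq_card_independent by blast
      then have "dim ?H \<le> dim S"
        using False uB(1,2) dim_hermitian by simp
      then have "S = ?H"
        using S H by (intro subspace_dim_equal) (auto simp: S_def)
      then have sp: "span (insert u B) = ?H"
        using uB(5) by simp
      have "E = edge_proj (insert u B)"
        using uB(5) by (intro edge_proj_eqI [OF E ho]) (simp add: S_def)
      moreover have "tensor_op (mat 1) (mat 1) = edge_proj (insert u B)"
      proof (rule edge_proj_eqI [OF _ _ ho])
        show "quantum_graph (tensor_op (mat 1) (mat 1 :: complex^2^2))"
          by (simp add: quantum_graph_def tensor_op_mult dagger_tensor_op dagger_mat_1)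
        show "undirected (tensor_op (mat 1) (mat 1 :: complex^2^2))"
          by (simp add: undirected_def swap_op_tensor_op)
        show "span (insert u B) = {x. dagger x = x \<and> tensor_op (mat 1) (mat 1) *v flat x = flat x}"
          unfolding sp by (simp add: tensor_op_1)
      qed
      ultimately show ?thesis by simp
    qed
  qed
qed

theorem proposition3p14:
  shows "(\<forall>m\<in>{1, 2, 3::nat}.
            (\<forall>t\<in>{0..pi/2}. \<exists>E :: complex^(2 \<times> 2)^(2 \<times> 2).
                quantum_graph E \<and> undirected E \<and> rank E = m \<and> adjacency E = family_adj m t) \<and>
            (\<forall>s\<in>{0..pi/2}. \<forall>t\<in>{0..pi/2}. s \<noteq> t \<longrightarrow>
                \<not> isomorphic_adj (family_adj m s) (family_adj m t)) \<and>
            infinite (family_adj m ` {0..pi/2})) \<and>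
         (\<forall>E :: complex^(2 \<times> 2)^(2 \<times> 2).
            quantum_graph E \<and> undirected E \<longrightarrow>
              (\<exists>m\<in>{1, 2, 3}. \<exists>t\<in>{0..pi/2}. isomorphic_adj (adjacency E) (family_adj m t)) \<or>
              adjacency E = (\<lambda>x. 0) \<or>
              E = tensor_op (mat 1) (mat 1))"
  using family_realized not_isomorphic_family_adj infinite_family_adj
    undirected_quantum_graph_classification by blast

end
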